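(* Let $k,m\ge 1$ and $l\ge 0$ be integers with $k=m+l$. Let $\mathcal R=(R_\alpha)_{\alpha\in J}$ be a family of planes (affine subspaces) in $\mathbb R^k$ of common dimension $l$, indexed by an infinite countable set $J$. Let $\Upsilon:J\to\{x\in\mathbb R:x\ge0\}$, $\alpha\mapsto\Upsilon_\alpha$, be a function such that for every $\epsilon>0$ the set $\{\alpha\in J:\Upsilon_\alpha>\epsilon\}$ is finite. Let $V$ be a linear subspace of $\mathbb R^k$ such that $\dim V=m=\operatorname{codim}\mathcal R$ (that is, $\dim V=m=k-l$) and (i) $V\cap R_\alpha\ne\emptyset$ for all $\alpha\in J$; (ii) $\sup_{\alpha\in J}\operatorname{diam}\big(V\cap\Delta(R_\alpha,1)\big)<\infty$. Let $f$ and $g:r\mapsto g(r):=r^{-l}f(r)$ be dimension functions such that $r\mapsto r^{-k}f(r)$ is monotonic, and let $\Omega$ be a ball in $\mathbb R^k$. Suppose that for any ball $B$ in $\Omega$, $$\mathcal H^k\Big(B\cap\Lambda\big(g(\Upsilon)^{1/m}\big)\Big)=\mathcal H^k(B).$$ Then, for any ball $B$ in $\Omega$, $$\mathcal H^f\big(B\cap\Lambda(\Upsilon)\big)=\mathcal H^f(B).$$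
   Context: For $\alpha\in J$ and $\delta\ge 0$, $\Delta(R_\alpha,\delta):=\{\mathbf x\in\mathbb R^k:\operatorname{dist}(\mathbf x,R_\alpha)<\delta\}$ (so it is empty if $\delta=0$). For a function $\Phi:J\to\{x\ge 0\}$, $\alpha\mapsto\Phi_\alpha$, define $\Lambda(\Phi):=\{\mathbf x\in\mathbb R^k:\mathbf x\in\Delta(R_\alpha,\Phi_\alpha)\text{ for infinitely many }\alpha\in J\}$. The notation $g(\Upsilon)^{1/m}$ means the function $\alpha\mapsto g(\Upsilon_\alpha)^{1/m}$. A dimension function is a continuous, non-decreasing function $f:\{x\ge 0\}\to\{x\ge 0\}$ with $f(r)\to 0$ as $r\to 0$. The function $g$ is given by the stated formula for $r>0$ and $g(0):=0$. Hausdorff $f$-measure: for $F\subset\mathbb R^k$ and $\rho>0$, $\mathcal H^f_\rho(F):=\inf\sum_i f(r(B_i))$, the infimum being over all countable collections of balls $B_i$ in $\mathbb R^k$ of radii $r(B_i)\le\rho$ covering $F$; and $\mathcal H^f(F):=\lim_{\rho\to 0}\mathcal H^f_\rho(F)=\sup_{\rho>0}\mathcal H^f_\rho(F)$. $\mathcal H^k$ denotes $\mathcal H^f$ with $f(r)=r^k$ (a constant multiple of $k$-dimensional Lebesgue measure). *)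

theory Defs
  imports "HOL-Analysis.Analysis"
begin

text \<open>A ball may be open or closed, always of positive radius.\<close>

definition ball_with_radius :: "'a::metric_space set \<Rightarrow> real \<Rightarrow> bool" where
  "ball_with_radius B r \<longleftrightarrow> 0 < r \<and> (\<exists>x. B = ball x r \<or> B = cball x r)"

definition is_ball :: "'a::metric_space set \<Rightarrow> bool" where
  "is_ball B \<longleftrightarrow> (\<exists>r. ball_with_radius B r)"

text \<open>
  Only the values of \<open>f\<close> on the nonnegative half-line matter.
\<close>

definition dimension_function :: "(real \<Rightarrow> real) \<Rightarrow> bool" where
  "dimension_function f \<longleftrightarrow>
     (\<forall>r\<ge>0. 0 \<le> f r) \<and> continuous_on {0..} f \<and> mono_on {0..} f \<and> (f \<longlongrightarrow> 0) (at_right 0)"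

text \<open>
  A cover is a countable set of pairs of a ball and its radius; a radius is carried along because
  in a general metric space it is not determined by the ball.  The sum and the infimum are taken
  in \<^typ>\<open>ennreal\<close>, so divergent sums have value infinity.
\<close>

definition hausdorff_premeasure ::
    "(real \<Rightarrow> real) \<Rightarrow> real \<Rightarrow> 'a::metric_space set \<Rightarrow> ennreal" where
  "hausdorff_premeasure f \<rho> F =
     (INF C \<in> {C. countable C \<and> (\<forall>(B, r)\<in>C. ball_with_radius B r \<and> r \<le> \<rho>)
                  \<and> F \<subseteq> (\<Union>(B, r)\<in>C. B)}.
        infsum (\<lambda>(B, r). ennreal (f r)) C)"

definition hausdorff_measure :: "(real \<Rightarrow> real) \<Rightarrow> 'a::metric_space set \<Rightarrow> ennreal" where
  "hausdorff_measure f F = (SUP \<rho>\<in>{0<..}. hausdorff_premeasure f \<rho> F)"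

text \<open>
  The library's \<^const>\<open>diameter\<close> is real-valued and meaningless on unbounded sets; here the
  diameter of an unbounded set is infinity.
\<close>

definition ediameter :: "'a::metric_space set \<Rightarrow> ennreal" where
  "ediameter S = (SUP x\<in>S. SUP y\<in>S. ennreal (dist x y))"

text \<open>
  The library's \<^const>\<open>infdist\<close> to the empty set is 0; these notions are used for nonempty \<open>S\<close>.
\<close>

definition nbhd :: "'a::metric_space set \<Rightarrow> real \<Rightarrow> 'a set" where
  "nbhd S \<delta> = {x. infdist x S < \<delta>}"

definition limsup_set ::
    "'j set \<Rightarrow> ('j \<Rightarrow> 'a::metric_space set) \<Rightarrow> ('j \<Rightarrow> real) \<Rightarrow> 'a set" where
  "limsup_set J R \<Phi> = {x. infinite {\<alpha>\<in>J. x \<in> nbhd (R \<alpha>) (\<Phi> \<alpha>)}}"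

end

theory Submission
  imports Defs
begin

text \<open>
  Write \<open>n = m + l\<close> for the dimension of the space, \<open>\<psi> \<alpha>\<close> for the \<open>m\<close>-th root of \<open>g (\<Upsilon> \<alpha>)\<close>, and
  \<open>h r\<close> for \<open>f r / r ^ n\<close>.  The hypothesis on \<open>\<psi>\<close> enters in the following form: the limsup set of
  the fat neighbourhoods (radius \<open>\<psi> \<alpha>\<close>) occupies at least a fixed proportion of the volume of every
  ball in \<open>\<Omega>\<close> (\<open>measure_Int_ge_if_full_hausdorff_measure\<close>), because the \<open>n\<close>-dimensional Hausdorff
  measure is comparable to volume.  By the Vitali covering lemma every ball in \<open>\<Omega>\<close> then contains
  finitely many well separated balls, centred at points of the planes \<open>R \<alpha>\<close> and of radii \<open>\<psi> \<alpha>\<close>, which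
  fill a fixed proportion of it; here \<open>\<alpha>\<close> may be required to avoid any given finite set
  (\<open>exists_packing\<close>).  Two cases remain.

  If \<open>h\<close> is bounded near \<open>0\<close>, then \<open>\<psi>\<close> is at most a multiple of \<open>\<Upsilon>\<close> at all but
  finitely many indices, so each ball of the packing
  contains a ball of comparable size inside the thin neighbourhood of its plane.  Hence the thin
  limsup set also fills a fixed proportion of every ball (\<open>limsup_set_volume_ge\<close>), and a set with this
  property has null complement (\<open>negligible_diff_if_fraction_of_balls\<close>).  Null sets are null for
  the \<open>f\<close>-measure, and the two sides agree.

  Otherwise \<open>h\<close> decreases and is unbounded, and the thin limsup set has infinite \<open>f\<close>-measure inside
  every closed ball of \<open>\<Omega>\<close>.  Suppose it were finite.  Then there is a countable cover by
  tiny balls \<open>D\<close> of radii \<open>t\<close> with convergent sum of the \<open>f t\<close>, and a point of the limsup set missed by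
  the cover is found as the limit of a decreasing sequence of balls.  The sequence keeps the
  invariant that the \<^emph>\<open>load\<close> of the current ball \<open>K\<close> of radius \<open>r\<close>, which is the sum of \<open>t ^ n\<close> over all
  \<open>D\<close> that meet \<open>K\<close>, is at most \<open>\<epsilon> * r ^ n\<close> for a fixed small \<open>\<epsilon>\<close>: this forces each \<open>D\<close> to miss the
  balls from some stage on.

  The next ball (\<open>exists_lighter_ball\<close>) is found by averaging.  Since the sum of the \<open>f t\<close> converges, the
  cover balls with \<open>t \<le> \<tau>\<close> contribute little to it if \<open>\<tau>\<close> is small.  Pack \<open>K\<close> with balls of radii
  \<open>\<psi> \<alpha> \<le> \<tau>\<close>, and in each of them place small balls (tiles) of radius \<open>\<Upsilon> \<alpha> / 2\<close> centred at the points of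
  a grid of mesh \<open>\<Upsilon> \<alpha>\<close> in the plane \<open>R \<alpha>\<close>.  Say that a cover ball of radius \<open>t\<close> does to a tile that it meets the damage
  \<open>t ^ n / (\<epsilon> * (\<Upsilon> \<alpha> / 2) ^ n)\<close>, or \<open>1\<close> if that is smaller; a tile whose total damage is less than \<open>1\<close>
  satisfies the invariant.  Divide the weight \<open>\<psi> \<alpha> ^ n\<close> equally among the tiles of one
  packing ball; as there are about \<open>(\<psi> \<alpha> / \<Upsilon> \<alpha>) ^ l\<close> of them, a tile has weight about
  \<open>\<psi> \<alpha> ^ m * \<Upsilon> \<alpha> ^ l = g (\<Upsilon> \<alpha>) * \<Upsilon> \<alpha> ^ l = f (\<Upsilon> \<alpha>)\<close>.  This identity is where the exponent \<open>1 / m\<close>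
  comes from, and together with the monotonicity of \<open>g\<close> (for \<open>t \<ge> \<Upsilon> \<alpha>\<close>) and of \<open>h\<close> (for \<open>t < \<Upsilon> \<alpha>\<close>) it
  shows that the damage done by a single \<open>D\<close>, weighted over all tiles, is at most
  \<open>3 ^ n * t ^ n\<close>, plus a constant times \<open>f t\<close> if \<open>t \<le> \<tau>\<close> (\<open>plane_tiles\<close>, \<open>packing_hit_le\<close>).  Summed over the \<open>D\<close> that meet
  \<open>K\<close>, this stays below the total weight of the tiles, so some tile has total damage less than \<open>1\<close>.
\<close>

section \<open>Countable sums and Hausdorff measures\<close>
lemma infsum_ennreal_eq_nn_integral:
  fixes f :: "'b \<Rightarrow> ennreal"
  assumes "countable A"
  shows "infsum f A = (\<integral>\<^sup>+x. f x \<partial>count_space A)"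
proof -
  have sup: "infsum f A = (SUP F\<in>{F. finite F \<and> F \<subseteq> A}. sum f F)"
    by (rule nonneg_infsum_complete) simp
  have "sum f F \<le> (\<integral>\<^sup>+x. f x \<partial>count_space A)" if "finite F" "F \<subseteq> A" for F
  proof -
    have "sum f F = (\<integral>\<^sup>+x. f x \<partial>count_space F)"
      using that by (simp add: nn_integral_count_space_finite)
    also have "\<dots> \<le> (\<integral>\<^sup>+x. f x \<partial>count_space A)"
      using that(2) by (auto simp: nn_integral_count_space_indicator indicator_def intro!: nn_integral_mono)
    finally show ?thesis .
  qed
  then have le: "infsum f A \<le> (\<integral>\<^sup>+x. f x \<partial>count_space A)"
    unfolding sup by (auto intro!: SUP_least)
  have "(\<integral>\<^sup>+x. f x \<partial>count_space A) \<le> infsum f A"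
  proof (cases "finite A")
    case True
    then show ?thesis by (simp add: nn_integral_count_space_finite)
  next
    case False
    define e where "e = from_nat_into A"
    have e: "bij_betw e UNIV A"
      unfolding e_def using assms False by (rule bij_betw_from_nat_into)
    have "(\<integral>\<^sup>+x. f x \<partial>count_space A) = (\<integral>\<^sup>+n. f (e n) \<partial>count_space UNIV)"
      by (rule nn_integral_bij_count_space[OF e, symmetric])
    also have "\<dots> = (\<Sum>n. f (e n))" by (rule nn_integral_count_space_nat)
    also have "\<dots> = (SUP n. \<Sum>i<n. f (e i))" by (rule suminf_eq_SUP)
    also have "\<dots> \<le> infsum f A"
    proof (rule SUP_least)
      fix n
      have inj: "inj_on e {..<n}" and im: "e ` {..<n} \<subseteq> A"
        using e by (auto simp: bij_betw_def intro: inj_on_subset)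
      have "(\<Sum>i<n. f (e i)) = sum f (e ` {..<n})"
        using inj by (simp add: sum.reindex)
      also have "\<dots> \<le> infsum f A"
        unfolding sup using im by (intro SUP_upper) auto
      finally show "(\<Sum>i<n. f (e i)) \<le> infsum f A" .
    qed
    finally show ?thesis .
  qed
  with le show ?thesis by (rule antisym)
qed

lemma emeasure_UN_le_nn_integral:
  assumes "countable A" "\<And>i. i \<in> A \<Longrightarrow> X i \<in> sets M"
  shows "emeasure M (\<Union>i\<in>A. X i) \<le> (\<integral>\<^sup>+i. emeasure M (X i) \<partial>count_space A)"
proof (cases "finite A")
  case True
  then show ?thesis
    using assms by (simp add: nn_integral_count_space_finite emeasure_subadditive_finite image_subset_iff)
next
  case False
  define e where "e = from_nat_into A"
  have e: "bij_betw e UNIV A"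
    unfolding e_def using assms(1) False by (rule bij_betw_from_nat_into)
  have "emeasure M (\<Union>i\<in>A. X i) = emeasure M (\<Union>n. X (e n))"
    using e by (simp add: bij_betw_def image_image flip: image_image)
  also have "\<dots> \<le> (\<Sum>n. emeasure M (X (e n)))"
    by (rule emeasure_subadditive_countably) (use e assms(2) in \<open>auto simp: bij_betw_def\<close>)
  also have "\<dots> = (\<integral>\<^sup>+n. emeasure M (X (e n)) \<partial>count_space UNIV)"
    by (rule nn_integral_count_space_nat[symmetric])
  also have "\<dots> = (\<integral>\<^sup>+i. emeasure M (X i) \<partial>count_space A)"
    by (rule nn_integral_bij_count_space[OF e])
  finally show ?thesis .
qed

definition fine_cover :: "real \<Rightarrow> 'a::metric_space set \<Rightarrow> ('a set \<times> real) set \<Rightarrow> bool" where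
  "fine_cover \<rho> F C \<longleftrightarrow> countable C \<and> (\<forall>D\<in>C. ball_with_radius (fst D) (snd D) \<and> snd D \<le> \<rho>)
     \<and> F \<subseteq> (\<Union>D\<in>C. fst D)"

text \<open>
  Sums over covers are treated as integrals over a counting measure, which makes dominated
  convergence and the interchange of sums available.
\<close>
lemma hausdorff_premeasure_eq:
  "hausdorff_premeasure f \<rho> F =
     (INF C\<in>{C. fine_cover \<rho> F C}. \<integral>\<^sup>+D. ennreal (f (snd D)) \<partial>count_space C)"
  unfolding hausdorff_premeasure_def fine_cover_def case_prod_unfold
  by (rule INF_cong) (simp_all add: infsum_ennreal_eq_nn_integral)

lemma hausdorff_premeasure_le:
  assumes "fine_cover \<rho> F C"
  shows "hausdorff_premeasure f \<rho> F \<le> (\<integral>\<^sup>+D. ennreal (f (snd D)) \<partial>count_space C)"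
  unfolding hausdorff_premeasure_eq by (rule INF_lower) (simp add: assms)

lemma hausdorff_premeasure_approx:
  assumes "hausdorff_premeasure f \<rho> F < c"
  obtains C where "fine_cover \<rho> F C" "(\<integral>\<^sup>+D. ennreal (f (snd D)) \<partial>count_space C) < c"
  using assms unfolding hausdorff_premeasure_eq INF_less_iff by blast

lemma fine_cover_mono:
  assumes "fine_cover \<sigma> F C" "E \<subseteq> F" "\<sigma> \<le> \<rho>"
  shows "fine_cover \<rho> E C"
  using assms unfolding fine_cover_def by (meson order_trans)

lemma hausdorff_premeasure_mono:
  "E \<subseteq> F \<Longrightarrow> hausdorff_premeasure f \<rho> E \<le> hausdorff_premeasure f \<rho> F"
  unfolding hausdorff_premeasure_eq by (rule INF_superset_mono) (auto intro: fine_cover_mono)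

lemma hausdorff_measure_mono: "E \<subseteq> F \<Longrightarrow> hausdorff_measure f E \<le> hausdorff_measure f F"
  unfolding hausdorff_measure_def by (rule SUP_mono') (rule hausdorff_premeasure_mono)

lemma hausdorff_premeasure_le_measure:
  "0 < \<rho> \<Longrightarrow> hausdorff_premeasure f \<rho> F \<le> hausdorff_measure f F"
  unfolding hausdorff_measure_def by (rule SUP_upper) simp

lemma hausdorff_premeasure_antimono:
  "\<sigma> \<le> \<rho> \<Longrightarrow> hausdorff_premeasure f \<rho> F \<le> hausdorff_premeasure f \<sigma> F"
  unfolding hausdorff_premeasure_eq by (rule INF_superset_mono) (auto intro: fine_cover_mono)

lemma hausdorff_measure_leI:
  assumes "0 < \<rho>0" "\<And>\<rho>. 0 < \<rho> \<Longrightarrow> \<rho> \<le> \<rho>0 \<Longrightarrow> hausdorff_premeasure f \<rho> F \<le> c"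
  shows "hausdorff_measure f F \<le> c"
  unfolding hausdorff_measure_def
proof (rule SUP_least)
  fix \<rho> :: real assume "\<rho> \<in> {0<..}"
  then have "hausdorff_premeasure f \<rho> F \<le> hausdorff_premeasure f (min \<rho> \<rho>0) F"
    by (intro hausdorff_premeasure_antimono) simp
  also have "\<dots> \<le> c" using assms(1) \<open>\<rho> \<in> {0<..}\<close> by (intro assms(2)) auto
  finally show "hausdorff_premeasure f \<rho> F \<le> c" .
qed

lemma hausdorff_premeasure_Un:
  "hausdorff_premeasure f \<rho> (E \<union> F) \<le> hausdorff_premeasure f \<rho> E + hausdorff_premeasure f \<rho> F"
proof (rule ennreal_le_epsilon)
  fix e :: real
  assume fin: "hausdorff_premeasure f \<rho> E + hausdorff_premeasure f \<rho> F < top" and "0 < e"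
  let ?I = "\<lambda>C. \<integral>\<^sup>+D. ennreal (f (snd D)) \<partial>count_space C"
  have "hausdorff_premeasure f \<rho> E < hausdorff_premeasure f \<rho> E + ennreal (e / 2)"
    "hausdorff_premeasure f \<rho> F < hausdorff_premeasure f \<rho> F + ennreal (e / 2)"
    using fin \<open>0 < e\<close> by (auto simp: ennreal_add_left_cancel_less[of _ 0, simplified])
  note less = this
  obtain C where C: "fine_cover \<rho> E C" "?I C < hausdorff_premeasure f \<rho> E + ennreal (e / 2)"
    using less(1) by (rule hausdorff_premeasure_approx)
  obtain D where D: "fine_cover \<rho> F D" "?I D < hausdorff_premeasure f \<rho> F + ennreal (e / 2)"
    using less(2) by (rule hausdorff_premeasure_approx)
  have "fine_cover \<rho> (E \<union> F) (C \<union> D)"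
    using C(1) D(1) by (simp add: fine_cover_def ball_Un le_supI1 le_supI2)
  then have "hausdorff_premeasure f \<rho> (E \<union> F) \<le> ?I (C \<union> D)" by (rule hausdorff_premeasure_le)
  also have "\<dots> = (\<integral>\<^sup>+X. ennreal (f (snd X)) * indicator (C \<union> D) X \<partial>count_space UNIV)"
    by (rule nn_integral_count_space_indicator) simp
  also have "\<dots> \<le> (\<integral>\<^sup>+X. ennreal (f (snd X)) * indicator C X + ennreal (f (snd X)) * indicator D X \<partial>count_space UNIV)"
    by (rule nn_integral_mono) (auto simp: indicator_def)
  also have "\<dots> = ?I C + ?I D"
    by (simp add: nn_integral_add nn_integral_count_space_indicator)
  also have "\<dots> \<le> (hausdorff_premeasure f \<rho> E + ennreal (e / 2)) + (hausdorff_premeasure f \<rho> F + ennreal (e / 2))"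
    using C(2) D(2) by (intro add_mono) auto
  also have "\<dots> = hausdorff_premeasure f \<rho> E + hausdorff_premeasure f \<rho> F + (ennreal (e/2) + ennreal (e / 2))"
    by (simp add: ac_simps)
  also have "ennreal (e/2) + ennreal (e / 2) = ennreal e"
    using \<open>0 < e\<close> by (subst ennreal_plus[symmetric]) auto
  finally show "hausdorff_premeasure f \<rho> (E \<union> F) \<le> hausdorff_premeasure f \<rho> E + hausdorff_premeasure f \<rho> F + ennreal e" .
qed

lemma hausdorff_measure_eq_if_null_diff:
  assumes "hausdorff_measure f (B - E) = 0"
  shows "hausdorff_measure f (B \<inter> E) = hausdorff_measure f B"
proof (rule antisym)
  show "hausdorff_measure f (B \<inter> E) \<le> hausdorff_measure f B"
    by (rule hausdorff_measure_mono) simp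
  show "hausdorff_measure f B \<le> hausdorff_measure f (B \<inter> E)"
  proof (rule hausdorff_measure_leI)
    fix \<rho> :: real assume "0 < \<rho>"
    have "hausdorff_premeasure f \<rho> B \<le> hausdorff_premeasure f \<rho> (B \<inter> E) + hausdorff_premeasure f \<rho> (B - E)"
      using hausdorff_premeasure_Un[of f \<rho> "B \<inter> E" "B - E"] by (simp add: Int_Diff_Un)
    also have "hausdorff_premeasure f \<rho> (B - E) = 0"
      using hausdorff_premeasure_le_measure[OF \<open>0 < \<rho>\<close>, of f "B - E"] assms by simp
    finally show "hausdorff_premeasure f \<rho> B \<le> hausdorff_measure f (B \<inter> E)"
      using hausdorff_premeasure_le_measure[OF \<open>0 < \<rho>\<close>, of f "B \<inter> E"] by simp
  qed (rule zero_less_one)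
qed

lemma ball_with_radius_cball: "0 < r \<Longrightarrow> ball_with_radius (cball x r) r"
  by (auto simp: ball_with_radius_def)

lemma ball_with_radius_emeasure:
  fixes D :: "'a::euclidean_space set"
  assumes "ball_with_radius D t"
  shows "emeasure lborel D = ennreal (unit_ball_vol (DIM('a)) * t ^ DIM('a))" "D \<in> sets borel"
  using assms by (auto simp: ball_with_radius_def emeasure_ball emeasure_cball)

section \<open>Hausdorff measures and volume\<close>

text \<open>
  Any cover of a ball has at least its volume, and all balls have volume proportional to the
  power of their radius.
\<close>
lemma hausdorff_measure_ball_ge:
  fixes B :: "'a::euclidean_space set"
  assumes B: "ball_with_radius B r"
  shows "ennreal (r ^ DIM('a)) \<le> hausdorff_measure (\<lambda>t. t ^ DIM('a)) B"
proof (rule ccontr)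
  let ?\<omega> = "ennreal (unit_ball_vol (DIM('a)))"
  assume "\<not> ?thesis"
  then have "hausdorff_premeasure (\<lambda>t. t ^ DIM('a)) 1 B < ennreal (r ^ DIM('a))"
    using hausdorff_premeasure_le_measure[of 1 "\<lambda>t. t ^ DIM('a)" B] by (simp add: not_le)
  then obtain C where C: "fine_cover 1 B C"
    and I: "(\<integral>\<^sup>+D. ennreal (snd D ^ DIM('a)) \<partial>count_space C) < ennreal (r ^ DIM('a))"
    by (rule hausdorff_premeasure_approx)
  have vol: "emeasure lborel D = ?\<omega> * ennreal (t ^ DIM('a))" if "ball_with_radius D t" for D :: "'a set" and t
    using ball_with_radius_emeasure(1)[OF that] that
    by (simp add: ennreal_mult ball_with_radius_def unit_ball_vol_nonneg)
  have cov: "ball_with_radius (fst D) (snd D)" if "D \<in> C" for D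
    using C that by (auto simp: fine_cover_def)
  have "?\<omega> * ennreal (r ^ DIM('a)) = emeasure lborel B" by (simp add: vol[OF B])
  also have "\<dots> \<le> emeasure lborel (\<Union>D\<in>C. fst D)"
    using C ball_with_radius_emeasure(2)[OF cov]
    by (intro emeasure_mono) (auto simp: fine_cover_def intro!: sets.countable_UN')
  also have "\<dots> \<le> (\<integral>\<^sup>+D. emeasure lborel (fst D) \<partial>count_space C)"
    using C ball_with_radius_emeasure(2)[OF cov]
    by (intro emeasure_UN_le_nn_integral) (auto simp: fine_cover_def)
  also have "\<dots> = (\<integral>\<^sup>+D. ?\<omega> * ennreal (snd D ^ DIM('a)) \<partial>count_space C)"
    by (intro nn_integral_cong) (use vol cov in auto)
  also have "\<dots> = ?\<omega> * (\<integral>\<^sup>+D. ennreal (snd D ^ DIM('a)) \<partial>count_space C)"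
    by (rule nn_integral_cmult) simp
  also have "\<dots> < ?\<omega> * ennreal (r ^ DIM('a))"
    using I by (intro ennreal_mult_strict_left_mono) (auto simp: unit_ball_vol_pos)
  finally show False by simp
qed

text \<open>
  Take an open set slightly larger than \<open>E\<close>.  The Vitali covering lemma yields disjoint small balls
  inside it whose fivefold enlargements cover \<open>E\<close>; the volume of the disjoint balls is bounded by
  that of the open set, and the enlargement costs the factor \<open>5 ^ n\<close>.
\<close>
lemma hausdorff_measure_le_volume:
  fixes E :: "'a::euclidean_space set"
  assumes E: "E \<in> sets lebesgue" and "0 \<le> c"
    and f: "\<And>t. 0 < t \<Longrightarrow> t \<le> 1 \<Longrightarrow> f t \<le> c * t ^ DIM('a)"
  shows "ennreal (unit_ball_vol (DIM('a))) * hausdorff_measure f E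
         \<le> ennreal (c * 5 ^ DIM('a)) * emeasure lebesgue E"
proof -
  let ?\<omega> = "ennreal (unit_ball_vol (DIM('a)))"
  let ?K = "ennreal (c * 5 ^ DIM('a))"
  have "?\<omega> * hausdorff_premeasure f \<rho> E \<le> ?K * emeasure lebesgue E" if "0 < \<rho>" for \<rho>
  proof (rule ennreal_le_epsilon)
    fix e :: real assume "0 < e"
    define \<rho>' where "\<rho>' = min \<rho> 1"
    define d where "d = e / (c * 5 ^ DIM('a) + 1)"
    have "0 < d" using \<open>0 < e\<close> \<open>0 \<le> c\<close> unfolding d_def by (intro divide_pos_pos add_nonneg_pos) auto
    have Kd: "?K * ennreal d \<le> ennreal e"
    proof -
      have "0 \<le> c * 5 ^ DIM('a)" using \<open>0 \<le> c\<close> by simp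
      then have "c * 5 ^ DIM('a) * d \<le> (c * 5 ^ DIM('a) + 1) * d" "(c * 5 ^ DIM('a) + 1) * d = e"
        using \<open>0 < d\<close> by (intro mult_right_mono, simp_all) (simp add: d_def)
      then show ?thesis using \<open>0 < d\<close> \<open>0 \<le> c\<close> by (simp add: ennreal_mult[symmetric] ennreal_leI)
    qed
    obtain U where U: "open U" "E \<subseteq> U" "U - E \<in> lmeasurable" "emeasure lebesgue (U - E) < ennreal d"
      using sets_lebesgue_outer_open[OF E \<open>0 < d\<close>] .
    have "U \<in> sets lebesgue" using U(1) by auto
    have "emeasure lebesgue U = emeasure lebesgue E + emeasure lebesgue (U - E)"
      using E U \<open>U \<in> sets lebesgue\<close> by (subst plus_emeasure) (auto simp: Un_absorb1)
    also have "\<dots> \<le> emeasure lebesgue E + ennreal d" using U(4) by (intro add_mono) auto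
    finally have volU: "emeasure lebesgue U \<le> emeasure lebesgue E + ennreal d" .
    define P where "P = {(x, r). 0 < r \<and> r \<le> \<rho>' / 5 \<and> cball x r \<subseteq> U}"
    have covP: "E \<subseteq> (\<Union>p\<in>P. cball (fst p) (snd p))"
    proof
      fix x assume "x \<in> E"
      then obtain r where "0 < r" "cball x r \<subseteq> U"
        using U open_contains_cball by blast
      moreover have "cball x (min r (\<rho>' / 5)) \<subseteq> cball x r" by (rule subset_cball) simp
      moreover have "0 < \<rho>'" using that by (simp add: \<rho>'_def)
      ultimately have "(x, min r (\<rho>' / 5)) \<in> P" by (auto simp: P_def)
      moreover have "x \<in> cball (fst (x, min r (\<rho>' / 5))) (snd (x, min r (\<rho>' / 5)))"
        using \<open>0 < r\<close> \<open>0 < \<rho>'\<close> by simp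
      ultimately show "x \<in> (\<Union>p\<in>P. cball (fst p) (snd p))" by (rule UN_I)
    qed
    have radP: "0 < snd p \<and> snd p \<le> \<rho>' / 5" if "p \<in> P" for p
      using that by (auto simp: P_def)
    obtain C where C: "countable C" "C \<subseteq> P"
      "pairwise (\<lambda>p q. disjnt (cball (fst p) (snd p)) (cball (fst q) (snd q))) C"
      "E \<subseteq> (\<Union>p\<in>C. cball (fst p) (5 * snd p))"
      by (rule Vitali_covering_lemma_cballs[OF covP radP])
    have Cpos: "0 < snd p" "5 * snd p \<le> \<rho>'" "cball (fst p) (snd p) \<subseteq> U" if "p \<in> C" for p
      using subsetD[OF C(2) that] by (simp_all add: P_def case_prod_unfold)
    define \<D> where "\<D> = (\<lambda>p. (cball (fst p) (5 * snd p), 5 * snd p)) ` C"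
    have cov: "fine_cover \<rho> E \<D>"
      using C Cpos unfolding fine_cover_def \<D>_def
      by (auto intro!: ball_with_radius_cball simp: \<rho>'_def)
    have inj: "inj_on (\<lambda>p. (cball (fst p) (5 * snd p), 5 * snd p)) C"
      using Cpos(1) by (auto simp: inj_on_def cball_eq_cball_iff) (metis less_asym linorder_not_le prod.collapse)
    have disj: "disjoint_family_on (\<lambda>p. cball (fst p) (snd p)) C"
      using C(3) by (auto simp: disjoint_family_on_def pairwise_def disjnt_def)
    have one: "?\<omega> * ennreal (f (5 * snd p)) \<le> ?K * emeasure lborel (cball (fst p) (snd p))" if "p \<in> C" for p
    proof -
      have "f (5 * snd p) \<le> c * 5 ^ DIM('a) * snd p ^ DIM('a)"
        using f[of "5 * snd p"] Cpos[OF that] by (simp add: \<rho>'_def power_mult_distrib)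
      then have "?\<omega> * ennreal (f (5 * snd p)) \<le> ?\<omega> * ennreal (c * 5 ^ DIM('a) * snd p ^ DIM('a))"
        by (intro mult_left_mono ennreal_leI) auto
      also have "\<dots> = ?K * emeasure lborel (cball (fst p) (snd p))"
        using Cpos[OF that] \<open>0 \<le> c\<close> by (simp add: emeasure_cball ennreal_mult[symmetric] ac_simps)
      finally show ?thesis .
    qed
    have "?\<omega> * hausdorff_premeasure f \<rho> E \<le> ?\<omega> * (\<integral>\<^sup>+D. ennreal (f (snd D)) \<partial>count_space \<D>)"
      by (intro mult_left_mono hausdorff_premeasure_le[OF cov]) auto
    also have "(\<integral>\<^sup>+D. ennreal (f (snd D)) \<partial>count_space \<D>) = (\<integral>\<^sup>+p. ennreal (f (5 * snd p)) \<partial>count_space C)"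
      using nn_integral_bij_count_space[OF inj_on_imp_bij_betw[OF inj], of "\<lambda>D. ennreal (f (snd D))"]
      by (simp add: \<D>_def)
    also have "?\<omega> * \<dots> = (\<integral>\<^sup>+p. ?\<omega> * ennreal (f (5 * snd p)) \<partial>count_space C)"
      by (rule nn_integral_cmult[symmetric]) simp
    also have "\<dots> \<le> (\<integral>\<^sup>+p. ?K * emeasure lborel (cball (fst p) (snd p)) \<partial>count_space C)"
      by (rule nn_integral_mono) (simp add: one)
    also have "\<dots> = ?K * (\<integral>\<^sup>+p. emeasure lborel (cball (fst p) (snd p)) \<partial>count_space C)"
      by (rule nn_integral_cmult) simp
    also have "(\<integral>\<^sup>+p. emeasure lborel (cball (fst p) (snd p)) \<partial>count_space C)
        = emeasure lborel (\<Union>p\<in>C. cball (fst p) (snd p))"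
      by (rule emeasure_UN_countable[symmetric]) (use C(1) disj in auto)
    also have "?K * \<dots> \<le> ?K * emeasure lborel U"
      using Cpos(3) U(1) by (intro mult_left_mono emeasure_mono) auto
    also have "\<dots> \<le> ?K * (emeasure lebesgue E + ennreal d)"
      using volU U(1) by (intro mult_left_mono) auto
    also have "\<dots> = ?K * emeasure lebesgue E + ?K * ennreal d" by (simp add: distrib_left)
    also have "\<dots> \<le> ?K * emeasure lebesgue E + ennreal e"
      using Kd by (rule add_left_mono)
    finally show "?\<omega> * hausdorff_premeasure f \<rho> E \<le> ?K * emeasure lebesgue E + ennreal e"
      .
  qed
  then show ?thesis
    unfolding hausdorff_measure_def by (subst SUP_mult_left_ennreal) (auto intro!: SUP_least)
qed

text \<open>
  The comparisons above of Hausdorff measure with volume are not sharp, so equality of Hausdorff measures is only turned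
  into a lower bound for the proportion of the volume.
\<close>
lemma measure_Int_ge_if_full_hausdorff_measure:
  fixes B :: "'a::euclidean_space set"
  assumes B: "ball_with_radius B r" and L: "L \<in> sets lebesgue"
    and full: "hausdorff_measure (\<lambda>t. t ^ DIM('a)) (B \<inter> L) = hausdorff_measure (\<lambda>t. t ^ DIM('a)) B"
  shows "unit_ball_vol (DIM('a)) * (r / 5) ^ DIM('a) \<le> measure lebesgue (B \<inter> L)"
proof -
  let ?\<omega> = "unit_ball_vol (DIM('a))"
  have "0 < r" using B by (simp add: ball_with_radius_def)
  have "B \<in> lmeasurable" using B by (auto simp: ball_with_radius_def)
  then have fin: "B \<inter> L \<in> lmeasurable"
    using L by (rule fmeasurable_Int_fmeasurable)
  have "ennreal (?\<omega> * r ^ DIM('a)) = ennreal ?\<omega> * ennreal (r ^ DIM('a))"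
    using \<open>0 < r\<close> by (intro ennreal_mult) auto
  also have "\<dots> \<le> ennreal ?\<omega> * hausdorff_measure (\<lambda>t. t ^ DIM('a)) (B \<inter> L)"
    unfolding full by (intro mult_left_mono hausdorff_measure_ball_ge[OF B]) auto
  also have "\<dots> \<le> ennreal (1 * 5 ^ DIM('a)) * emeasure lebesgue (B \<inter> L)"
    using fin by (intro hausdorff_measure_le_volume) auto
  also have "\<dots> = ennreal (5 ^ DIM('a) * measure lebesgue (B \<inter> L))"
    using fin by (simp add: emeasure_eq_measure2 ennreal_mult)
  finally have "?\<omega> * r ^ DIM('a) \<le> 5 ^ DIM('a) * measure lebesgue (B \<inter> L)"
    by (subst (asm) ennreal_le_iff) auto
  then show ?thesis by (simp add: power_divide field_simps)
qed

section \<open>Limsup sets\<close>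

lemma nbhd_obtain:
  assumes "x \<in> nbhd S \<delta>" "S \<noteq> {}"
  obtains y where "y \<in> S" "dist x y < \<delta>"
proof -
  have "(INF a\<in>S. dist x a) < \<delta>" using assms by (simp add: nbhd_def infdist_notempty)
  then show thesis
    using that cINF_less_iff[OF assms(2), of "dist x" \<delta>] by (auto intro!: bdd_belowI[where m = 0])
qed

lemma open_nbhd: "open (nbhd S \<delta>)"
  unfolding nbhd_def by (intro open_Collect_less continuous_intros)

lemma limsup_set_eq_Inter_Union:
  "limsup_set J R \<Phi> = (\<Inter>F\<in>{F. finite F \<and> F \<subseteq> J}. \<Union>\<alpha>\<in>J - F. nbhd (R \<alpha>) (\<Phi> \<alpha>))"
proof (rule set_eqI)
  fix x
  let ?A = "{\<alpha>\<in>J. x \<in> nbhd (R \<alpha>) (\<Phi> \<alpha>)}"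
  have "infinite ?A \<longleftrightarrow> (\<forall>F. finite F \<and> F \<subseteq> J \<longrightarrow> \<not> ?A \<subseteq> F)"
  proof
    assume "infinite ?A"
    then show "\<forall>F. finite F \<and> F \<subseteq> J \<longrightarrow> \<not> ?A \<subseteq> F" by (meson finite_subset)
  next
    assume "\<forall>F. finite F \<and> F \<subseteq> J \<longrightarrow> \<not> ?A \<subseteq> F"
    from this[rule_format, of ?A] show "infinite ?A" by blast
  qed
  then show "x \<in> limsup_set J R \<Phi> \<longleftrightarrow>
      x \<in> (\<Inter>F\<in>{F. finite F \<and> F \<subseteq> J}. \<Union>\<alpha>\<in>J - F. nbhd (R \<alpha>) (\<Phi> \<alpha>))"
    by (auto simp: limsup_set_def)
qed

lemma limsup_set_borel:
  assumes "countable J"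
  shows "limsup_set J R \<Phi> \<in> sets borel"
proof -
  have "countable {F. finite F \<and> F \<subseteq> J}"
    using assms by (rule countable_Collect_finite_subset)
  then show ?thesis
    unfolding limsup_set_eq_Inter_Union
    by (intro sets.countable_INT'' borel_open open_UN ballI open_nbhd) auto
qed

lemma limsup_set_lebesgue: "countable J \<Longrightarrow> limsup_set J R \<Phi> \<in> sets lebesgue"
  by (metis limsup_set_borel sets_completionI_sets sets_lborel)

section \<open>Packing a ball with balls centred on the planes\<close>

text \<open>
  The doubled balls are disjoint, so that a ball of radius \<open>t\<close> can meet at most one ball of the packing
  whose radius exceeds \<open>t\<close>.
\<close>
definition packing :: "'j set \<Rightarrow> ('j \<Rightarrow> 'a::euclidean_space set) \<Rightarrow> ('j \<Rightarrow> real) \<Rightarrow> 'a \<Rightarrow> real \<Rightarrow> ('a \<times> 'j) set \<Rightarrow> bool" where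
  "packing J R \<psi> z r I \<longleftrightarrow> finite I
     \<and> (\<forall>(x, \<alpha>)\<in>I. \<alpha> \<in> J \<and> x \<in> R \<alpha> \<and> 0 < \<psi> \<alpha> \<and> cball x (\<psi> \<alpha>) \<subseteq> cball z r)
     \<and> pairwise (\<lambda>(x, \<alpha>) (y, \<beta>). disjnt (cball x (2 * \<psi> \<alpha>)) (cball y (2 * \<psi> \<beta>))) I"

text \<open>
  Each point of the limsup set in the concentric half-ball lies in a ball of radius \<open>\<psi> \<alpha>\<close> centred on
  some \<open>R \<alpha>\<close> with \<open>\<alpha>\<close> outside \<open>F\<close>, and that ball stays inside \<open>cball z r\<close>.  The Vitali
  covering lemma is applied to the doubled balls, so the covering balls have radii \<open>10 * \<psi> \<alpha>\<close>; a
  finite part of the selected family suffices because the inequality for the volume is strict.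
\<close>
lemma exists_packing:
  fixes R :: "'j \<Rightarrow> 'a::euclidean_space set"
  assumes ne: "\<And>\<alpha>. \<alpha> \<in> J \<Longrightarrow> R \<alpha> \<noteq> {}" and J: "countable J"
    and F: "finite F" and small: "\<And>\<alpha>. \<alpha> \<in> J - F \<Longrightarrow> \<psi> \<alpha> \<le> r / 4"
    and meas: "v < measure lebesgue (cball z (r / 2) \<inter> limsup_set J R \<psi>)"
  obtains I where "packing (J - F) R \<psi> z r I"
    "v < unit_ball_vol (DIM('a)) * 10 ^ DIM('a) * (\<Sum>p\<in>I. \<psi> (snd p) ^ DIM('a))"
proof -
  let ?\<omega> = "unit_ball_vol (DIM('a))"
  let ?L = "cball z (r / 2) \<inter> limsup_set J R \<psi>"
  define P where "P = {p. snd p \<in> J - F \<and> fst p \<in> R (snd p) \<and> 0 < \<psi> (snd p)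
                          \<and> cball (fst p) (\<psi> (snd p)) \<subseteq> cball z r}"
  have covP: "?L \<subseteq> (\<Union>p\<in>P. cball (fst p) (2 * \<psi> (snd p)))"
  proof
    fix x assume x: "x \<in> ?L"
    then have "infinite {\<alpha>\<in>J. x \<in> nbhd (R \<alpha>) (\<psi> \<alpha>)}" by (simp add: limsup_set_def)
    then have "\<not> {\<alpha>\<in>J. x \<in> nbhd (R \<alpha>) (\<psi> \<alpha>)} \<subseteq> F" using F finite_subset by blast
    then obtain \<alpha> where \<alpha>: "\<alpha> \<in> J - F" "x \<in> nbhd (R \<alpha>) (\<psi> \<alpha>)" by blast
    then obtain y where y: "y \<in> R \<alpha>" "dist x y < \<psi> \<alpha>" using ne nbhd_obtain by (metis DiffD1)
    have "cball y (\<psi> \<alpha>) \<subseteq> cball z r"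
    proof
      fix u assume "u \<in> cball y (\<psi> \<alpha>)"
      then have "dist z u \<le> r / 2 + (\<psi> \<alpha> + \<psi> \<alpha>)"
        using x y dist_triangle[of z u x] dist_triangle[of x u y] by simp
      then show "u \<in> cball z r" using small[OF \<alpha>(1)] by simp
    qed
    moreover have "0 < \<psi> \<alpha>" using y(2) by (meson le_less_trans zero_le_dist)
    ultimately have "(y, \<alpha>) \<in> P" using \<alpha>(1) y(1) by (simp add: P_def)
    moreover have "x \<in> cball (fst (y, \<alpha>)) (2 * \<psi> (snd (y, \<alpha>)))"
      using y(2) \<open>0 < \<psi> \<alpha>\<close> by (simp add: dist_commute)
    ultimately show "x \<in> (\<Union>p\<in>P. cball (fst p) (2 * \<psi> (snd p)))" by (rule UN_I)
  qed
  have radP: "0 < 2 * \<psi> (snd p) \<and> 2 * \<psi> (snd p) \<le> r / 2" if "p \<in> P" for p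
    using that small[of "snd p"] by (simp add: P_def)
  obtain C where C: "countable C" "C \<subseteq> P"
    "pairwise (\<lambda>p q. disjnt (cball (fst p) (2 * \<psi> (snd p))) (cball (fst q) (2 * \<psi> (snd q)))) C"
    "?L \<subseteq> (\<Union>p\<in>C. cball (fst p) (5 * (2 * \<psi> (snd p))))"
    by (rule Vitali_covering_lemma_cballs[OF covP radP])
  have pos: "0 < \<psi> (snd p)" if "p \<in> C" for p using radP[OF subsetD[OF C(2) that]] by simp
  have "\<exists>I. finite I \<and> I \<subseteq> C \<and> v < ?\<omega> * 10 ^ DIM('a) * (\<Sum>p\<in>I. \<psi> (snd p) ^ DIM('a))"
  proof (rule ccontr)
    assume "\<not> ?thesis"
    then have le: "?\<omega> * 10 ^ DIM('a) * (\<Sum>p\<in>I. \<psi> (snd p) ^ DIM('a)) \<le> v"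
      if "finite I" "I \<subseteq> C" for I
      using that not_le by blast
    let ?X = "\<lambda>p. cball (fst p) (5 * (2 * \<psi> (snd p)))"
    have fin: "?X p \<in> lmeasurable" for p by simp
    have bd: "measure lebesgue (\<Union>p\<in>I. ?X p) \<le> v" if "I \<subseteq> C" "finite I" for I
    proof -
      have "measure lebesgue (\<Union>p\<in>I. ?X p) \<le> (\<Sum>p\<in>I. measure lebesgue (?X p))"
        by (rule measure_UNION_le) (use that in auto)
      also have "\<dots> = (\<Sum>p\<in>I. ?\<omega> * (10 * \<psi> (snd p)) ^ DIM('a))"
      proof (rule sum.cong[OF refl])
        fix p assume "p \<in> I"
        then have "0 < \<psi> (snd p)" using pos that(1) by blast
        then show "measure lebesgue (?X p) = ?\<omega> * (10 * \<psi> (snd p)) ^ DIM('a)"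
          by (simp add: content_cball)
      qed
      also have "\<dots> = ?\<omega> * 10 ^ DIM('a) * (\<Sum>p\<in>I. \<psi> (snd p) ^ DIM('a))"
        by (simp add: power_mult_distrib sum_distrib_left ac_simps)
      also have "\<dots> \<le> v" using le that by blast
      finally show ?thesis .
    qed
    have "measure lebesgue ?L \<le> measure lebesgue (\<Union>p\<in>C. ?X p)"
    proof (rule measure_mono_fmeasurable[OF C(4)])
      show "?L \<in> sets lebesgue" using limsup_set_lebesgue[OF J] by (intro sets.Int) auto
      show "(\<Union>p\<in>C. ?X p) \<in> lmeasurable" by (rule fmeasurable_UN_bound[OF C(1) fin bd])
    qed
    also have "\<dots> \<le> v" by (rule measure_UN_bound[OF C(1) fin bd])
    finally show False using meas by simp
  qed
  then obtain I where I: "finite I" "I \<subseteq> C"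
    "v < ?\<omega> * 10 ^ DIM('a) * (\<Sum>p\<in>I. \<psi> (snd p) ^ DIM('a))" by blast
  have "packing (J - F) R \<psi> z r I"
    unfolding packing_def
    using I(1) subset_trans[OF I(2) C(2)] pairwise_subset[OF C(3) I(2)]
    by (auto simp: P_def case_prod_unfold)
  then show thesis using I(3) by (rule that)
qed

section \<open>The case of comparable radii\<close>

text \<open>
  Shrinking the balls of a packing by the factor \<open>\<kappa>\<close> puts them into the thin neighbourhoods.  This
  bounds the volume of the union over \<open>J - F\<close> from below for every finite \<open>F\<close>, and the limsup set is the decreasing
  limit of such unions.
\<close>
lemma limsup_set_volume_ge:
  fixes R :: "'j \<Rightarrow> 'a::euclidean_space set"
  assumes ne: "\<And>\<alpha>. \<alpha> \<in> J \<Longrightarrow> R \<alpha> \<noteq> {}" and J: "countable J"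
    and small: "\<And>e. 0 < e \<Longrightarrow> finite {\<alpha>\<in>J. \<not> \<psi> \<alpha> \<le> e}"
    and \<kappa>: "1 \<le> \<kappa>" "finite {\<alpha>\<in>J. \<not> \<psi> \<alpha> \<le> \<kappa> * \<Upsilon> \<alpha>}"
    and "0 < r" "0 < v" "v < measure lebesgue (cball z (r / 2) \<inter> limsup_set J R \<psi>)"
  shows "v / (10 * \<kappa>) ^ DIM('a) \<le> measure lebesgue (cball z r \<inter> limsup_set J R \<Upsilon>)"
proof -
  let ?\<omega> = "unit_ball_vol (DIM('a))"
  define W where "W F = cball z r \<inter> (\<Union>\<alpha>\<in>J - F. nbhd (R \<alpha>) (\<Upsilon> \<alpha>))" for F
  have Wm: "W F \<in> lmeasurable" for F
  proof -
    have "open (\<Union>\<alpha>\<in>J - F. nbhd (R \<alpha>) (\<Upsilon> \<alpha>))" by (intro open_UN ballI open_nbhd)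
    then show ?thesis unfolding W_def by (intro fmeasurable_Int_fmeasurable) auto
  qed
  have W: "v / (10 * \<kappa>) ^ DIM('a) \<le> measure lebesgue (W F)" if "finite F" for F
  proof -
    define F' where "F' = F \<union> {\<alpha>\<in>J. \<not> \<psi> \<alpha> \<le> r / 4} \<union> {\<alpha>\<in>J. \<not> \<psi> \<alpha> \<le> \<kappa> * \<Upsilon> \<alpha>}"
    have "finite F'" using that small[of "r / 4"] \<kappa>(2) \<open>0 < r\<close> by (simp add: F'_def)
    have smF: "\<psi> \<alpha> \<le> r / 4" if "\<alpha> \<in> J - F'" for \<alpha> using that by (auto simp: F'_def)
    obtain I where I: "packing (J - F') R \<psi> z r I"
      and v: "v < ?\<omega> * 10 ^ DIM('a) * (\<Sum>p\<in>I. \<psi> (snd p) ^ DIM('a))"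
      by (rule exists_packing[OF ne J \<open>finite F'\<close> smF assms(8)])
    define X where "X = (\<lambda>p::'a \<times> 'j. ball (fst p) (\<psi> (snd p) / \<kappa>))"
    have p: "snd p \<in> J - F'" "fst p \<in> R (snd p)" "0 < \<psi> (snd p)"
      "cball (fst p) (\<psi> (snd p)) \<subseteq> cball z r" if "p \<in> I" for p
      using I that by (auto simp: packing_def case_prod_unfold)
    have le: "\<psi> (snd p) / \<kappa> \<le> \<psi> (snd p)" "\<psi> (snd p) / \<kappa> \<le> \<Upsilon> (snd p)" if "p \<in> I" for p
      using p[OF that] \<kappa>(1) by (auto simp: F'_def field_simps)
    have sub: "X p \<subseteq> W F" if "p \<in> I" for p
    proof
      fix u assume "u \<in> X p"
      then have d: "dist (fst p) u < \<psi> (snd p) / \<kappa>" by (simp add: X_def)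
      then have "u \<in> cball z r" using le[OF that] p(4)[OF that] by (auto simp: subset_iff)
      moreover have "u \<in> nbhd (R (snd p)) (\<Upsilon> (snd p))"
        using d le(2)[OF that] infdist_le[OF p(2)[OF that], of u] by (simp add: nbhd_def dist_commute)
      ultimately show "u \<in> W F" using p(1)[OF that] by (auto simp: W_def F'_def)
    qed
    have "disjoint_family_on X I"
      unfolding disjoint_family_on_def
    proof (intro ballI impI)
      fix p q assume pq: "p \<in> I" "q \<in> I" "p \<noteq> q"
      then have "disjnt (cball (fst p) (2 * \<psi> (snd p))) (cball (fst q) (2 * \<psi> (snd q)))"
        using I by (auto simp: packing_def pairwise_def case_prod_unfold)
      moreover have "X p \<subseteq> cball (fst p) (2 * \<psi> (snd p))" if "p \<in> I" for p
        using le(1)[OF that] p(3)[OF that] unfolding X_def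
        by (intro order_trans[OF ball_subset_cball] subset_cball) simp
      ultimately show "X p \<inter> X q = {}" using pq unfolding disjnt_def by blast
    qed
    have "v / (10 * \<kappa>) ^ DIM('a) \<le> (?\<omega> * 10 ^ DIM('a) * (\<Sum>p\<in>I. \<psi> (snd p) ^ DIM('a))) / (10 * \<kappa>) ^ DIM('a)"
      using v \<kappa>(1) by (intro divide_right_mono) auto
    also have "\<dots> = (\<Sum>p\<in>I. ?\<omega> * (\<psi> (snd p) / \<kappa>) ^ DIM('a))"
      using \<kappa>(1) by (simp add: power_mult_distrib power_divide sum_distrib_left sum_divide_distrib field_simps)
    also have "\<dots> = (\<Sum>p\<in>I. measure lebesgue (X p))"
      using p \<kappa>(1) by (intro sum.cong) (auto simp: X_def content_ball less_imp_le)
    also have "\<dots> = measure lebesgue (\<Union>p\<in>I. X p)"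
    proof (rule measure_finite_Union[symmetric])
      have "X p \<in> lmeasurable" for p by (simp add: X_def)
      then show "X ` I \<subseteq> sets lebesgue" "\<And>p. emeasure lebesgue (X p) \<noteq> \<infinity>"
        by (blast dest: fmeasurableD, metis fmeasurableD2 infinity_ennreal_def)
    qed (use I \<open>disjoint_family_on X I\<close> in \<open>simp_all add: packing_def\<close>)
    also have "\<dots> \<le> measure lebesgue (W F)"
    proof (rule measure_mono_fmeasurable[OF _ _ Wm])
      show "(\<Union>p\<in>I. X p) \<subseteq> W F" using sub by (rule UN_least)
      have "open (\<Union>p\<in>I. X p)" by (auto simp: X_def)
      then show "(\<Union>p\<in>I. X p) \<in> sets lebesgue" by auto
    qed
    finally show ?thesis .
  qed
  define G where "G n = (from_nat_into J ` {..<n::nat})" for n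
  have lim: "(\<lambda>n. measure lebesgue (W (G n))) \<longlonglongrightarrow> measure lebesgue (\<Inter>n. W (G n))"
  proof (rule Lim_measure_decseq)
    show "range (\<lambda>n. W (G n)) \<subseteq> sets lebesgue" using Wm by auto
    show "decseq (\<lambda>n. W (G n))" unfolding decseq_def W_def G_def by fastforce
    show "emeasure lebesgue (W (G n)) \<noteq> \<infinity>" for n using Wm[of "G n"] by (auto simp: fmeasurable_def)
  qed
  have "(\<Inter>n. W (G n)) = cball z r \<inter> limsup_set J R \<Upsilon>"
  proof (rule antisym)
    show "(\<Inter>n. W (G n)) \<subseteq> cball z r \<inter> limsup_set J R \<Upsilon>"
    proof
      fix x assume x: "x \<in> (\<Inter>n. W (G n))"
      have "\<exists>\<alpha>\<in>J - F. x \<in> nbhd (R \<alpha>) (\<Upsilon> \<alpha>)" if "finite F" "F \<subseteq> J" for F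
      proof -
        have "\<exists>n. \<alpha> \<in> G n" if "\<alpha> \<in> J" for \<alpha>
          using from_nat_into_surj[OF J that] by (auto simp: G_def)
        then have "\<forall>\<alpha>\<in>F. \<exists>n. \<alpha> \<in> G n" using that by blast
        then obtain n where n: "\<And>\<alpha>. \<alpha> \<in> F \<Longrightarrow> \<alpha> \<in> G (n \<alpha>)" by metis
        have "F \<subseteq> G (Max (insert 0 (n ` F)))"
        proof
          fix \<alpha> assume "\<alpha> \<in> F"
          then have "n \<alpha> \<le> Max (insert 0 (n ` F))" using that by simp
          then have "G (n \<alpha>) \<subseteq> G (Max (insert 0 (n ` F)))"
            unfolding G_def by (intro image_mono) auto
          then show "\<alpha> \<in> G (Max (insert 0 (n ` F)))" using n[OF \<open>\<alpha> \<in> F\<close>] by blast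
        qed
        moreover have "x \<in> W (G (Max (insert 0 (n ` F))))" using x by blast
        ultimately show ?thesis unfolding W_def by blast
      qed
      then show "x \<in> cball z r \<inter> limsup_set J R \<Upsilon>"
        using x by (auto simp: limsup_set_eq_Inter_Union W_def)
    qed
    show "cball z r \<inter> limsup_set J R \<Upsilon> \<subseteq> (\<Inter>n. W (G n))"
    proof
      fix x assume x: "x \<in> cball z r \<inter> limsup_set J R \<Upsilon>"
      have "x \<in> W (G n)" for n
      proof -
        have "\<not> {\<alpha>\<in>J. x \<in> nbhd (R \<alpha>) (\<Upsilon> \<alpha>)} \<subseteq> G n"
          using x finite_subset[of _ "G n"] by (auto simp: limsup_set_def G_def)
        then show ?thesis using x by (auto simp: W_def)
      qed
      then show "x \<in> (\<Inter>n. W (G n))" by blast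
    qed
  qed
  with lim have "(\<lambda>n. measure lebesgue (W (G n))) \<longlonglongrightarrow> measure lebesgue (cball z r \<inter> limsup_set J R \<Upsilon>)"
    by simp
  then show ?thesis
    by (rule LIMSEQ_le_const) (use W in \<open>auto simp: G_def\<close>)
qed

text \<open>
  A consequence of the Lebesgue density theorem, obtained here directly from a Vitali covering: let \<open>T\<close> be an open set around the complement \<open>A\<close> with
  \<open>T - A\<close> of small volume.  Disjoint balls in \<open>T\<close> cover almost all of \<open>A\<close>, and each of them has a fixed
  proportion of its volume in \<open>E\<close>, hence in \<open>T - A\<close>; so the volume of \<open>A\<close> is at most a multiple of that of \<open>T - A\<close>.
\<close>
lemma negligible_diff_if_fraction_of_balls:
  fixes \<Omega> E :: "'a::euclidean_space set"
  assumes \<Omega>: "open \<Omega>" "bounded \<Omega>" and E: "E \<in> sets lebesgue" and "0 < c"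
    and frac: "\<And>z r. 0 < r \<Longrightarrow> cball z r \<subseteq> \<Omega> \<Longrightarrow>
                 c * measure lebesgue (cball z r) \<le> measure lebesgue (cball z r \<inter> E)"
  shows "negligible (\<Omega> - E)"
proof -
  define A where "A = \<Omega> - E"
  have \<Omega>m: "\<Omega> \<in> lmeasurable" using \<Omega> by (simp add: lmeasurable_open)
  then have Am: "A \<in> lmeasurable" using E by (simp add: A_def fmeasurable_Diff)
  have "measure lebesgue A \<le> e" if "0 < e" for e
  proof -
    have "0 < c * e" using \<open>0 < c\<close> that by simp
    obtain T where T: "open T" "A \<subseteq> T" "T - A \<in> lmeasurable" "emeasure lebesgue (T - A) < ennreal (c * e)"
      using sets_lebesgue_outer_open[OF fmeasurableD[OF Am] \<open>0 < c * e\<close>] .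
    define U where "U = T \<inter> \<Omega>"
    have U: "open U" "A \<subseteq> U" using T \<Omega> by (auto simp: U_def A_def)
    define P where "P = {p. 0 < snd p \<and> cball (fst p) (snd p) \<subseteq> U}"
    have posP: "0 < snd p" if "p \<in> P" for p using that by (simp add: P_def)
    have fineP: "\<exists>p. p \<in> P \<and> x \<in> cball (fst p) (snd p) \<and> snd p < d" if "x \<in> A" "0 < d" for x d
    proof -
      have "x \<in> U" using U(2) that(1) by blast
      then obtain s where s: "0 < s" "cball x s \<subseteq> U"
        using open_contains_cball_eq[OF U(1)] by auto
      have "cball x (min s (d / 2)) \<subseteq> cball x s" by (rule subset_cball) simp
      with s that(2) have "(x, min s (d / 2)) \<in> P" by (simp add: P_def)
      moreover have "x \<in> cball x (min s (d / 2))" "min s (d / 2) < d" using s that(2) by auto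
      ultimately show ?thesis by (metis fst_conv snd_conv)
    qed
    obtain C where C: "countable C" "C \<subseteq> P"
      "pairwise (\<lambda>p q. disjnt (cball (fst p) (snd p)) (cball (fst q) (snd q))) C"
      "negligible (A - (\<Union>p\<in>C. cball (fst p) (snd p)))"
      by (rule Vitali_covering_theorem_cballs[OF posP fineP])
    define X where "X = (\<lambda>p::'a \<times> real. cball (fst p) (snd p))"
    have XU: "X p \<subseteq> U" "0 < snd p" if "p \<in> C" for p using subsetD[OF C(2) that] by (simp_all add: P_def X_def)
    have disj: "disjoint_family_on X C"
      using C(3) by (auto simp: disjoint_family_on_def pairwise_def disjnt_def X_def)
    have one: "ennreal c * emeasure lebesgue (X p) \<le> emeasure lebesgue (X p \<inter> E)" if "p \<in> C" for p
    proof -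
      have "X p \<in> lmeasurable" "X p \<inter> E \<in> lmeasurable"
        using E by (auto simp: X_def intro!: fmeasurable_Int_fmeasurable)
      moreover have "c * measure lebesgue (X p) \<le> measure lebesgue (X p \<inter> E)"
        using frac[of "snd p" "fst p"] XU[OF that] by (auto simp: X_def U_def)
      ultimately show ?thesis
        using \<open>0 < c\<close> by (simp add: emeasure_eq_measure2 ennreal_mult[symmetric] ennreal_leI)
    qed
    have "X p \<in> sets lebesgue" for p by (simp add: X_def)
    then have XC: "(\<Union>p\<in>C. X p) \<in> sets lebesgue" by (intro sets.countable_UN' C(1)) blast
    have "emeasure lebesgue A \<le> emeasure lebesgue (\<Union>p\<in>C. X p)"
    proof -
      have "emeasure lebesgue A \<le> emeasure lebesgue ((\<Union>p\<in>C. X p) \<union> (A - (\<Union>p\<in>C. X p)))"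
        using XC fmeasurableD[OF Am] by (intro emeasure_mono sets.Un sets.Diff) auto
      also have "\<dots> = emeasure lebesgue (\<Union>p\<in>C. X p)"
        using XC C(4) by (intro emeasure_Un_null_set) (simp_all add: X_def negligible_iff_null_sets)
      finally show ?thesis .
    qed
    then have "ennreal c * emeasure lebesgue A \<le> ennreal c * emeasure lebesgue (\<Union>p\<in>C. X p)"
      by (intro mult_left_mono) auto
    also have "\<dots> = (\<integral>\<^sup>+p. ennreal c * emeasure lebesgue (X p) \<partial>count_space C)"
      using C(1) disj by (subst emeasure_UN_countable) (auto simp: X_def nn_integral_cmult)
    also have "\<dots> \<le> (\<integral>\<^sup>+p. emeasure lebesgue (X p \<inter> E) \<partial>count_space C)"
      by (rule nn_integral_mono) (simp add: one)
    also have "\<dots> = emeasure lebesgue (\<Union>p\<in>C. X p \<inter> E)"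
    proof (rule emeasure_UN_countable[symmetric])
      show "disjoint_family_on (\<lambda>p. X p \<inter> E) C"
        using disj unfolding disjoint_family_on_def by blast
    qed (use C(1) E in \<open>auto simp: X_def\<close>)
    also have "\<dots> \<le> emeasure lebesgue (T - A)"
    proof (rule emeasure_mono)
      show "(\<Union>p\<in>C. X p \<inter> E) \<subseteq> T - A" using XU(1) by (auto simp: U_def A_def)
      show "T - A \<in> sets lebesgue" using T(3) by (rule fmeasurableD)
    qed
    also have "\<dots> \<le> ennreal (c * e)" using T(4) by simp
    finally have "ennreal (c * measure lebesgue A) \<le> ennreal (c * e)"
      using Am \<open>0 < c\<close> by (simp add: emeasure_eq_measure2 ennreal_mult)
    then show ?thesis using \<open>0 < c\<close> that by (simp add: ennreal_le_iff)
  qed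
  then have "measure lebesgue A \<le> 0" by (rule field_le_epsilon[of _ 0, simplified])
  then have "measure lebesgue A = 0" by (simp add: measure_le_0_iff)
  then show ?thesis using Am by (simp add: A_def negligible_iff_measure)
qed

section \<open>Grids of tiles in a plane\<close>
lemma card_grid_interval_le:
  fixes u t a :: real
  assumes "0 < u" "u \<le> t"
  shows "finite {k::nat. \<bar>real k * u - a\<bar> \<le> t}" "real (card {k::nat. \<bar>real k * u - a\<bar> \<le> t}) \<le> 3 * t / u"
proof -
  let ?S = "{k::nat. \<bar>real k * u - a\<bar> \<le> t}" and ?J = "{\<lceil>(a - t) / u\<rceil>..\<lfloor>(a + t) / u\<rfloor>}"
  have "int k \<in> ?J" if "k \<in> ?S" for k
  proof -
    have "(a - t) / u \<le> real k" "real k \<le> (a + t) / u"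
      using that \<open>0 < u\<close> by (auto simp: divide_le_eq le_divide_eq)
    then show ?thesis by (simp add: ceiling_le_iff le_floor_iff)
  qed
  then have sub: "int ` ?S \<subseteq> ?J" by blast
  show fin: "finite ?S"
    using finite_subset[OF sub] by (simp add: finite_image_iff)
  have "card ?S = card (int ` ?S)" by (simp add: card_image)
  also have "\<dots> \<le> card ?J" by (rule card_mono) (use sub in auto)
  finally have "real (card ?S) \<le> real (card ?J)" by simp
  also have "\<dots> \<le> 2 * t / u + 1"
  proof -
    have "0 \<le> 2 * t / u + 1" using assms by simp
    moreover have "of_int \<lfloor>(a + t) / u\<rfloor> \<le> (a + t) / u" "(a - t) / u \<le> of_int \<lceil>(a - t) / u\<rceil>" by auto
    moreover have "(a + t) / u - (a - t) / u = 2 * t / u" by (simp add: add_divide_distrib diff_divide_distrib)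
    ultimately have "of_int (\<lfloor>(a + t) / u\<rfloor> - \<lceil>(a - t) / u\<rceil> + 1) \<le> 2 * t / u + 1" by linarith
    moreover have "real (nat z) \<le> q" if "of_int z \<le> q" "0 \<le> q" for z :: int and q :: real
      using that by (cases "0 \<le> z") auto
    ultimately show ?thesis using \<open>0 \<le> 2 * t / u + 1\<close> by simp
  qed
  also have "\<dots> \<le> 3 * t / u" using assms by (simp add: field_simps)
  finally show "real (card ?S) \<le> 3 * t / u" .
qed

text \<open>
  The points are those of a cubical grid of mesh \<open>u\<close> with respect to an orthonormal basis of the
  direction of \<open>S\<close>.  Both bounds also hold for \<open>l = 0\<close>, where the grid is the single point \<open>x\<close>.
\<close>
lemma exists_lattice_points:
  fixes S :: "'a::euclidean_space set"
  assumes S: "affine S" "aff_dim S = int l" "x \<in> S" and "0 < u" "0 < \<rho>"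
  obtains P where "finite P" "P \<noteq> {}" "P \<subseteq> S \<inter> cball x (\<rho> / 2)"
    "(\<rho> / u) ^ l \<le> (2 * real l) ^ l * real (card P)"
    "\<And>y t. u \<le> t \<Longrightarrow> real (card {p\<in>P. dist p y \<le> t}) \<le> (3 * t / u) ^ l"
proof -
  define T where "T = (\<lambda>y. y - x) ` S"
  have T: "subspace T" unfolding T_def using S by (intro affine_diffs_subspace_subtract) auto
  have "aff_dim T = aff_dim S" unfolding T_def by (rule aff_dim_translation_eq_subtract)
  with S(2) T have dimT: "dim T = l" by (simp add: aff_dim_subspace)
  obtain B where B: "B \<subseteq> T" "pairwise orthogonal B" "\<And>b. b \<in> B \<Longrightarrow> norm b = 1"
    "independent B" "card B = dim T" "span B = T"
    using orthonormal_basis_subspace[OF T] by blast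
  have finB: "finite B" using B(4) by (rule independent_imp_finite)
  have cardB: "card B = l" using B(5) dimT by simp
  \<comment> \<open>The triangle inequality, applied along the \<open>l\<close> coordinate directions, keeps the grid in the ball.\<close>
  define N where "N = nat \<lfloor>\<rho> / (2 * real l * u)\<rfloor> + 1"
  define A where "A = (\<Pi>\<^sub>E b\<in>B. {..<N})"
  define pt where "pt c = x + (\<Sum>b\<in>B. (real (c b) * u) *\<^sub>R b)" for c :: "'a \<Rightarrow> nat"
  have coord: "(pt c - x) \<bullet> b = real (c b) * u" if "b \<in> B" for c b
  proof -
    have "(pt c - x) \<bullet> b = (\<Sum>b'\<in>B. (real (c b') * u) * (b' \<bullet> b))"
      by (simp add: pt_def inner_sum_left)
    also have "\<dots> = (\<Sum>b'\<in>B. if b' = b then real (c b) * u else 0)"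
      using B(2,3) that
      by (intro sum.cong) (auto simp: pairwise_def orthogonal_def dot_square_norm)
    also have "\<dots> = real (c b) * u" using finB that by simp
    finally show ?thesis .
  qed
  have inj: "inj_on pt A"
  proof (rule inj_onI)
    fix c d assume cd: "c \<in> A" "d \<in> A" "pt c = pt d"
    have "c b = d b" if "b \<in> B" for b
      using coord[OF that, of c] coord[OF that, of d] cd(3) \<open>0 < u\<close> by simp
    then show "c = d" using cd(1,2) unfolding A_def by (intro PiE_ext)
  qed
  have "card (pt ` A) = card A" by (rule card_image[OF inj])
  also have "\<dots> = N ^ l" using finB by (simp add: A_def card_PiE cardB)
  finally have cardP: "card (pt ` A) = N ^ l" .
  have Nbd: "real (c b) \<le> \<rho> / (2 * real l * u)" if "c \<in> A" "b \<in> B" for c b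
  proof -
    have "c b \<in> {..<N}" using that unfolding A_def by (rule PiE_mem)
    then have "real (c b) \<le> real (nat \<lfloor>\<rho> / (2 * real l * u)\<rfloor>)" unfolding N_def by simp
    also have "\<dots> \<le> \<rho> / (2 * real l * u)" using \<open>0 < \<rho>\<close> \<open>0 < u\<close> by simp
    finally show ?thesis .
  qed
  show thesis
  proof
    show "finite (pt ` A)" using finB by (simp add: A_def finite_PiE)
    show "pt ` A \<noteq> {}" by (auto simp: A_def PiE_eq_empty_iff N_def lessThan_empty_iff)
    show "pt ` A \<subseteq> S \<inter> cball x (\<rho> / 2)"
    proof safe
      fix c assume c: "c \<in> A"
      have "(\<Sum>b\<in>B. (real (c b) * u) *\<^sub>R b) \<in> T"
        using B(1) T by (intro subspace_sum subspace_scale) auto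
      then show "pt c \<in> S" by (auto simp: T_def pt_def)
      have "norm (pt c - x) \<le> (\<Sum>b\<in>B. norm ((real (c b) * u) *\<^sub>R b))"
        unfolding pt_def add_diff_cancel_left' by (rule norm_sum)
      also have "\<dots> = (\<Sum>b\<in>B. real (c b) * u)"
        using B(3) \<open>0 < u\<close> by (intro sum.cong) auto
      also have "\<dots> \<le> (\<Sum>b\<in>B. \<rho> / (2 * real l * u) * u)"
        using Nbd[OF c] \<open>0 < u\<close> by (intro sum_mono mult_right_mono) auto
      also have "\<dots> \<le> \<rho> / 2"
        using \<open>0 < u\<close> \<open>0 < \<rho>\<close> by (cases "l = 0") (auto simp: cardB)
      finally show "pt c \<in> cball x (\<rho> / 2)" by (simp add: dist_norm norm_minus_commute)
    qed
    have "\<rho> / (2 * real l * u) \<le> real N" unfolding N_def by linarith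
    then have "\<rho> / u \<le> 2 * real l * real N \<or> l = 0"
      using \<open>0 < u\<close> by (auto simp: field_simps)
    then have "(\<rho> / u) ^ l \<le> (2 * real l * real N) ^ l"
      using \<open>0 < u\<close> \<open>0 < \<rho>\<close> by (auto intro: power_mono)
    then show "(\<rho> / u) ^ l \<le> (2 * real l) ^ l * real (card (pt ` A))"
      by (simp add: cardP power_mult_distrib)
    show "real (card {p \<in> pt ` A. dist p y \<le> t}) \<le> (3 * t / u) ^ l" if "u \<le> t" for y t
    proof -
      define Q where "Q b = {k::nat. \<bar>real k * u - (y - x) \<bullet> b\<bar> \<le> t}" for b
      have Q: "finite (Q b)" "real (card (Q b)) \<le> 3 * t / u" for b
        unfolding Q_def using card_grid_interval_le[OF \<open>0 < u\<close> that] by auto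
      have "{p \<in> pt ` A. dist p y \<le> t} \<subseteq> pt ` (\<Pi>\<^sub>E b\<in>B. Q b)"
      proof safe
        fix c assume c: "c \<in> A" "dist (pt c) y \<le> t"
        have "c b \<in> Q b" if "b \<in> B" for b
        proof -
          have "real (c b) * u - (y - x) \<bullet> b = (pt c - y) \<bullet> b"
            using coord[OF that, of c] by (simp add: inner_diff_left)
          also have "\<bar>\<dots>\<bar> \<le> norm (pt c - y) * norm b" by (rule Cauchy_Schwarz_ineq2)
          finally show ?thesis using c(2) B(3)[OF that] by (simp add: Q_def dist_norm)
        qed
        then have "c \<in> (\<Pi>\<^sub>E b\<in>B. Q b)" using c(1) unfolding A_def PiE_iff by auto
        then show "pt c \<in> pt ` (\<Pi>\<^sub>E b\<in>B. Q b)" by blast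
      qed
      then have "card {p \<in> pt ` A. dist p y \<le> t} \<le> card (pt ` (\<Pi>\<^sub>E b\<in>B. Q b))"
        using finB Q(1) by (intro card_mono) (auto intro!: finite_PiE)
      also have "\<dots> \<le> card (\<Pi>\<^sub>E b\<in>B. Q b)"
        using finB Q(1) by (intro card_image_le finite_PiE) auto
      also have "\<dots> = (\<Prod>b\<in>B. card (Q b))" using finB by (rule card_PiE)
      finally have "real (card {p \<in> pt ` A. dist p y \<le> t}) \<le> (\<Prod>b\<in>B. real (card (Q b)))"
        by (metis of_nat_le_iff of_nat_prod)
      also have "\<dots> \<le> (\<Prod>b\<in>B. 3 * t / u)" using Q(2) by (intro prod_mono) auto
      finally show ?thesis by (simp add: cardB)
    qed
  qed
qed

text \<open>
  The situation in which the \<open>f\<close>-measure of every ball is infinite.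
\<close>
locale steep_gauge =
  fixes f g :: "real \<Rightarrow> real" and m l :: nat
  assumes m_pos: "1 \<le> m"
    and f_eq: "\<And>t. 0 < t \<Longrightarrow> f t = g t * t ^ l"
    and g_mono: "\<And>s t. 0 < s \<Longrightarrow> s \<le> t \<Longrightarrow> g s \<le> g t"
    and g_lim: "(g \<longlongrightarrow> 0) (at_right 0)"
    and ratio_antimono: "\<And>s t. 0 < s \<Longrightarrow> s \<le> t \<Longrightarrow> f t / t ^ (m + l) \<le> f s / s ^ (m + l)"
    and ratio_unbounded: "\<And>A. \<exists>t>0. A < f t / t ^ (m + l)"
begin

lemma ratio_large: "\<exists>\<tau>>0. \<forall>t. 0 < t \<longrightarrow> t \<le> \<tau> \<longrightarrow> A * t ^ (m + l) \<le> f t"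
proof -
  obtain \<tau> where \<tau>: "0 < \<tau>" "A < f \<tau> / \<tau> ^ (m + l)" using ratio_unbounded by blast
  have "A * t ^ (m + l) \<le> f t" if "0 < t" "t \<le> \<tau>" for t
  proof -
    have "A \<le> f t / t ^ (m + l)" using \<tau>(2) ratio_antimono[OF that] by simp
    then show ?thesis using that by (simp add: le_divide_eq)
  qed
  with \<tau>(1) show ?thesis by blast
qed

lemma g_nonneg: "0 < t \<Longrightarrow> 0 \<le> g t"
proof -
  assume "0 < t"
  have "eventually (\<lambda>s. g s \<le> g t) (at_right 0)"
    unfolding eventually_at_right_field using \<open>0 < t\<close> g_mono by (intro exI[of _ t]) auto
  then show ?thesis by (intro tendsto_upperbound[OF g_lim]) auto
qed

lemma f_nonneg: "0 < t \<Longrightarrow> 0 \<le> f t"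
  using g_nonneg by (simp add: f_eq)

text \<open>
  The left-hand side bounds the weighted damage done to the tiles of one packing ball by a cover
  ball with centre \<open>y\<close> and radius \<open>t\<close>: a tile \<open>cball p (u / 2)\<close> has weight \<open>\<rho> ^ n\<close> divided by the number of
  tiles, it can be met only if \<open>dist p y \<le> t + u / 2\<close>, and the damage to it is \<open>t ^ n\<close> relative to the
  admissible load \<open>\<epsilon> * (u / 2) ^ n\<close>, cut off at \<open>1\<close>.  If \<open>t \<ge> u\<close>, about \<open>(t / u) ^ l\<close> tiles of
  weight \<open>f u = g u * u ^ l\<close> are met, and \<open>g u \<le> g t\<close>.  If \<open>t < u\<close>, the number of tiles met is
  bounded, and \<open>f u * (t / u) ^ n \<le> f t\<close> since \<open>f r / r ^ n\<close> decreases.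
\<close>
lemma plane_tiles:
  fixes S :: "'a::euclidean_space set"
  assumes dim: "DIM('a) = m + l" and S: "affine S" "aff_dim S = int l" "x \<in> S"
    and u: "0 < u" "u \<le> \<rho>" "\<rho> ^ m = g u" and "0 < \<epsilon>"
  obtains P where "finite P" "P \<noteq> {}" "P \<subseteq> S \<inter> cball x (\<rho> / 2)"
    "\<And>y t. 0 < t \<Longrightarrow>
       \<rho> ^ DIM('a) / card P * (card {p\<in>P. dist p y \<le> t + u / 2} * min 1 (t ^ DIM('a) / (\<epsilon> * (u / 2) ^ DIM('a))))
         \<le> (10 * real l) ^ l * (1 + 2 ^ DIM('a) / \<epsilon>) * f t"
proof -
  let ?n = "DIM('a)"
  have "0 < \<rho>" using u by simp
  obtain P where P: "finite P" "P \<noteq> {}" "P \<subseteq> S \<inter> cball x (\<rho> / 2)"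
    "(\<rho> / u) ^ l \<le> (2 * real l) ^ l * real (card P)"
    "\<And>y t. u \<le> t \<Longrightarrow> real (card {p\<in>P. dist p y \<le> t}) \<le> (3 * t / u) ^ l"
    using exists_lattice_points[OF S \<open>0 < u\<close> \<open>0 < \<rho>\<close>] by blast
  have cP: "0 < real (card P)" using P by (simp add: card_gt_0_iff)
  have weight: "\<rho> ^ ?n / card P \<le> (2 * real l) ^ l * f u"
  proof -
    have "\<rho> ^ ?n = \<rho> ^ m * u ^ l * (\<rho> / u) ^ l"
      using \<open>0 < u\<close> by (simp add: dim power_add power_divide)
    also have "\<dots> = f u * (\<rho> / u) ^ l" using u by (simp add: f_eq)
    also have "\<dots> \<le> f u * ((2 * real l) ^ l * real (card P))"
      using P(4) f_nonneg[OF u(1)] by (rule mult_left_mono)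
    finally show ?thesis using cP by (simp add: divide_le_eq ac_simps)
  qed
  have main: "\<rho> ^ ?n / card P * (card {p\<in>P. dist p y \<le> t + u / 2} * min 1 (t ^ ?n / (\<epsilon> * (u / 2) ^ ?n)))
      \<le> (10 * real l) ^ l * (1 + 2 ^ ?n / \<epsilon>) * f t" (is "?w * (?c * ?k) \<le> _") if "0 < t" for y t
  proof -
    define s where "s = max t u"
    have s: "0 < s" "t \<le> s" "u \<le> s" using \<open>0 < t\<close> by (auto simp: s_def)
    have k0: "0 \<le> ?k" using \<open>0 < \<epsilon>\<close> u(1) that by simp
    have "{p\<in>P. dist p y \<le> t + u / 2} \<subseteq> {p\<in>P. dist p y \<le> 3 / 2 * s}" using s by auto
    then have "card {p\<in>P. dist p y \<le> t + u / 2} \<le> card {p\<in>P. dist p y \<le> 3 / 2 * s}"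
      using P(1) by (intro card_mono) auto
    then have "?c \<le> real (card {p\<in>P. dist p y \<le> 3 / 2 * s})" by simp
    also have "\<dots> \<le> (3 * (3 / 2 * s) / u) ^ l" using s by (intro P(5)) simp
    also have "\<dots> \<le> (5 * s / u) ^ l" using s u(1) by (intro power_mono divide_right_mono) auto
    finally have c: "?c \<le> (5 * s / u) ^ l" .
    have "?w * (?c * ?k) \<le> ((2 * real l) ^ l * f u) * ((5 * s / u) ^ l * ?k)"
      using weight c k0 f_nonneg[OF u(1)] by (intro mult_mono mult_nonneg_nonneg) auto
    also have "\<dots> = ((2 * real l) ^ l * (5 * s / u) ^ l) * (f u * ?k)" by (simp only: ac_simps)
    also have "(2 * real l) ^ l * (5 * s / u) ^ l = (10 * real l) ^ l * (s / u) ^ l"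
    proof -
      have "2 * real l * (5 * s / u) = 10 * real l * (s / u)" by simp
      then show ?thesis by (metis power_mult_distrib)
    qed
    also have "(10 * real l) ^ l * (s / u) ^ l * (f u * ?k) = (10 * real l) ^ l * (f u * (s / u) ^ l * ?k)"
      by (simp only: ac_simps)
    finally have bound: "?w * (?c * ?k) \<le> (10 * real l) ^ l * (f u * (s / u) ^ l * ?k)" .
    have "f u * (s / u) ^ l * ?k \<le> (1 + 2 ^ ?n / \<epsilon>) * f t"
    proof (cases "u \<le> t")
      case True
      then have "f u * (s / u) ^ l = g u * t ^ l"
        using u(1) by (simp add: s_def f_eq power_divide)
      also have "\<dots> \<le> f t" using g_mono[OF u(1) True] that by (simp add: f_eq mult_right_mono)
      finally have "f u * (s / u) ^ l * ?k \<le> f t * 1"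
        using k0 f_nonneg[OF that] by (intro mult_mono) auto
      also have "\<dots> \<le> (1 + 2 ^ ?n / \<epsilon>) * f t"
        using f_nonneg[OF that] \<open>0 < \<epsilon>\<close> by (simp add: distrib_right)
      finally show ?thesis .
    next
      case False
      then have "f u * (s / u) ^ l * ?k = f u * ?k" using u(1) by (simp add: s_def)
      also have "\<dots> \<le> f u * (t ^ ?n / (\<epsilon> * (u / 2) ^ ?n))"
        using f_nonneg[OF u(1)] by (intro mult_left_mono) auto
      also have "\<dots> = 2 ^ ?n / \<epsilon> * (f u / u ^ ?n * t ^ ?n)"
        by (simp add: power_divide ac_simps)
      also have "\<dots> \<le> 2 ^ ?n / \<epsilon> * (f t / t ^ ?n * t ^ ?n)"
        using ratio_antimono[OF that, of u] False that \<open>0 < \<epsilon>\<close>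
        by (intro mult_left_mono mult_right_mono) (auto simp: dim)
      also have "\<dots> \<le> (1 + 2 ^ ?n / \<epsilon>) * f t"
        using f_nonneg[OF that] that by (simp add: distrib_right)
      finally show ?thesis .
    qed
    then have "(10 * real l) ^ l * (f u * (s / u) ^ l * ?k) \<le> (10 * real l) ^ l * ((1 + 2 ^ ?n / \<epsilon>) * f t)"
      by (rule mult_left_mono) simp
    with bound show ?thesis by (simp only: mult.assoc)
  qed
  show thesis by (rule that[OF P(1-3) main])
qed

end

section \<open>Averaging over the tiles\<close>

text \<open>
  Here \<open>s i\<close> stands for the weighted damage done by a cover ball with centre \<open>y\<close> and radius \<open>t\<close> to the
  tiles of the packing ball \<open>i\<close>.  The packing balls of radius at most \<open>t\<close> that are affected lie in \<open>cball y (3 * t)\<close>, so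
  their total weight is bounded by volume; and \<open>y\<close> belongs to the doubled ball of any larger one
  that is affected, so there is at most one of these.
\<close>
lemma packing_hit_le:
  fixes R :: "'j \<Rightarrow> 'a::euclidean_space set"
  assumes I: "packing J R \<psi> z r I" and "0 < t" "0 \<le> b"
    and s: "\<And>i. i \<in> I \<Longrightarrow> 0 \<le> s i" "\<And>i. i \<in> I \<Longrightarrow> s i \<le> \<psi> (snd i) ^ DIM('a)"
      "\<And>i. i \<in> I \<Longrightarrow> t < \<psi> (snd i) \<Longrightarrow> s i \<le> b"
      "\<And>i. i \<in> I \<Longrightarrow> s i \<noteq> 0 \<Longrightarrow> dist (fst i) y \<le> t + \<psi> (snd i)"
  shows "(\<Sum>i\<in>I. s i) \<le> (3 * t) ^ DIM('a) + (if \<exists>i\<in>I. t < \<psi> (snd i) then b else 0)"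
proof -
  let ?\<omega> = "unit_ball_vol (DIM('a))"
  define A where "A = {i\<in>I. \<psi> (snd i) \<le> t \<and> s i \<noteq> 0}"
  define L where "L = {i\<in>I. t < \<psi> (snd i) \<and> s i \<noteq> 0}"
  have fin: "finite I" using I by (simp add: packing_def)
  have pos: "0 < \<psi> (snd i)" if "i \<in> I" for i
    using I that by (auto simp: packing_def case_prod_unfold)
  have disj: "disjnt (cball (fst i) (2 * \<psi> (snd i))) (cball (fst j) (2 * \<psi> (snd j)))"
    if "i \<in> I" "j \<in> I" "i \<noteq> j" for i j
    using I that by (auto simp: packing_def pairwise_def case_prod_unfold)
  have "(\<Sum>i\<in>I. s i) = (\<Sum>i\<in>A \<union> L. s i)"
    using fin by (intro sum.mono_neutral_right) (auto simp: A_def L_def)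
  also have "\<dots> = (\<Sum>i\<in>A. s i) + (\<Sum>i\<in>L. s i)"
    using fin by (intro sum.union_disjoint) (auto simp: A_def L_def)
  finally have split: "(\<Sum>i\<in>I. s i) = (\<Sum>i\<in>A. s i) + (\<Sum>i\<in>L. s i)" .
  have "?\<omega> * (\<Sum>i\<in>A. s i) \<le> ?\<omega> * (3 * t) ^ DIM('a)"
  proof -
    let ?X = "\<lambda>i::'a \<times> 'j. cball (fst i) (\<psi> (snd i))"
    have dA: "disjoint_family_on ?X A"
      unfolding disjoint_family_on_def
    proof (intro ballI impI)
      fix i j assume ij: "i \<in> A" "j \<in> A" "i \<noteq> j"
      have "?X i \<subseteq> cball (fst i) (2 * \<psi> (snd i))" if "i \<in> A" for i
        using pos[of i] that by (intro subset_cball) (simp add: A_def)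
      then show "?X i \<inter> ?X j = {}"
        using disj[of i j] ij unfolding A_def disjnt_def by blast
    qed
    have "?\<omega> * (\<Sum>i\<in>A. s i) \<le> (\<Sum>i\<in>A. ?\<omega> * \<psi> (snd i) ^ DIM('a))"
      unfolding sum_distrib_left using s(2) by (intro sum_mono mult_left_mono) (auto simp: A_def)
    also have "\<dots> = (\<Sum>i\<in>A. measure lebesgue (?X i))"
    proof (rule sum.cong[OF refl])
      fix i assume "i \<in> A"
      then have "0 < \<psi> (snd i)" using pos by (simp add: A_def)
      then show "?\<omega> * \<psi> (snd i) ^ DIM('a) = measure lebesgue (?X i)" by (simp add: content_cball)
    qed
    also have "\<dots> = measure lebesgue (\<Union>i\<in>A. ?X i)"
    proof (rule measure_finite_Union[symmetric, OF _ _ dA])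
      show "finite A" using fin by (simp add: A_def)
      have "?X i \<in> lmeasurable" for i by simp
      then show "?X ` A \<subseteq> sets lebesgue" "\<And>i. emeasure lebesgue (?X i) \<noteq> \<infinity>"
        by (blast dest: fmeasurableD, metis fmeasurableD2 infinity_ennreal_def)
    qed
    also have "\<dots> \<le> measure lebesgue (cball y (3 * t))"
    proof (rule measure_mono_fmeasurable)
      show "(\<Union>i\<in>A. ?X i) \<subseteq> cball y (3 * t)"
      proof (intro UN_least subsetI)
        fix i x assume "i \<in> A" "x \<in> ?X i"
        then show "x \<in> cball y (3 * t)"
          using s(4)[of i] dist_triangle[of y x "fst i"] by (auto simp: A_def dist_commute)
      qed
      have "finite A" using fin by (simp add: A_def)
      then show "(\<Union>i\<in>A. ?X i) \<in> sets lebesgue" by (intro sets.finite_UN) auto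
    qed simp
    also have "\<dots> = ?\<omega> * (3 * t) ^ DIM('a)" using \<open>0 < t\<close> by (simp add: content_cball)
    finally show ?thesis .
  qed
  then have A: "(\<Sum>i\<in>A. s i) \<le> (3 * t) ^ DIM('a)" by simp
  have L: "(\<Sum>i\<in>L. s i) \<le> (if \<exists>i\<in>I. t < \<psi> (snd i) then b else 0)"
  proof (cases "L = {}")
    case True
    then show ?thesis using \<open>0 \<le> b\<close> by simp
  next
    case False
    have "i = j" if "i \<in> L" "j \<in> L" for i j
    proof (rule ccontr)
      assume "i \<noteq> j"
      moreover have "y \<in> cball (fst i) (2 * \<psi> (snd i))" if "i \<in> L" for i
        using s(4)[of i] that by (auto simp: L_def)
      ultimately show False using disj[of i j] that unfolding L_def disjnt_def by blast
    qed
    then obtain i where "L = {i}" using False by blast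
    then show ?thesis using s(3)[of i] by (auto simp: L_def)
  qed
  show ?thesis using split A L by simp
qed

lemma cover_tail_small:
  assumes fin: "(\<integral>\<^sup>+D. ennreal (F D) \<partial>count_space C) < \<infinity>" and pos: "\<And>D. D \<in> C \<Longrightarrow> 0 < t D" and "0 < \<eta>"
  obtains \<tau> :: real where "0 < \<tau>" "(\<integral>\<^sup>+D. ennreal (F D) * indicator {D. t D \<le> \<tau>} D \<partial>count_space C) < ennreal \<eta>"
proof -
  let ?h = "\<lambda>k D. ennreal (F D) * indicator {D. t D \<le> 1 / real (Suc k)} D"
  have "(\<lambda>k. \<integral>\<^sup>+D. ?h k D \<partial>count_space C) \<longlonglongrightarrow> (\<integral>\<^sup>+D. 0 \<partial>count_space C)"
  proof (rule nn_integral_dominated_convergence[where w = "\<lambda>D. ennreal (F D)"])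
    show "AE D in count_space C. (\<lambda>k. ?h k D) \<longlonglongrightarrow> 0"
    proof (rule AE_I2)
      fix D assume "D \<in> space (count_space C)"
      then have "0 < t D" using pos by simp
      then obtain k0 where k0: "1 / real (Suc k0) < t D" using nat_approx_posE by metis
      have "eventually (\<lambda>k. ?h k D = 0) sequentially"
      proof (rule eventually_sequentiallyI[of k0])
        fix k assume "k0 \<le> k"
        then have "1 / real (Suc k) \<le> 1 / real (Suc k0)" by (intro divide_left_mono) auto
        then show "?h k D = 0" using k0 by (simp add: indicator_def)
      qed
      then show "(\<lambda>k. ?h k D) \<longlonglongrightarrow> 0" by (rule tendsto_eventually)
    qed
    show "\<And>k. AE D in count_space C. ?h k D \<le> ennreal (F D)"
      by (intro AE_I2) (simp add: indicator_def)
  qed (use fin in auto)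
  then have "eventually (\<lambda>k. (\<integral>\<^sup>+D. ?h k D \<partial>count_space C) < ennreal \<eta>) sequentially"
    using \<open>0 < \<eta>\<close> by (intro order_tendstoD(2)) auto
  then obtain k where "(\<integral>\<^sup>+D. ?h k D \<partial>count_space C) < ennreal \<eta>"
    by (auto simp: eventually_sequentially)
  then show thesis by (intro that[of "1 / real (Suc k)"]) simp_all
qed

definition load :: "('a::euclidean_space set \<times> real) set \<Rightarrow> 'a set \<Rightarrow> ennreal" where
  "load C K = (\<integral>\<^sup>+D. ennreal (snd D ^ DIM('a)) * indicator {D. fst D \<inter> K \<noteq> {}} D \<partial>count_space C)"

locale plane_system = steep_gauge f g m l
  for f g :: "real \<Rightarrow> real" and m l :: nat +
  fixes J :: "'j set" and R :: "'j \<Rightarrow> 'a::euclidean_space set" and \<Upsilon> \<psi> :: "'j \<Rightarrow> real"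
    and \<Omega> :: "'a set" and c :: real
  assumes dim: "DIM('a) = m + l" and J: "countable J"
    and planes: "\<And>\<alpha>. \<alpha> \<in> J \<Longrightarrow> affine (R \<alpha>) \<and> aff_dim (R \<alpha>) = int l"
    and \<Upsilon>_nonneg: "\<And>\<alpha>. \<alpha> \<in> J \<Longrightarrow> 0 \<le> \<Upsilon> \<alpha>"
    and \<Upsilon>_small: "\<And>e. 0 < e \<Longrightarrow> finite {\<alpha>\<in>J. \<Upsilon> \<alpha> > e}"
    and \<psi>_def: "\<psi> = (\<lambda>\<alpha>. root m (g (\<Upsilon> \<alpha>)))" and g_zero: "g 0 = 0"
    and c_pos: "0 < c"
    and ample: "\<And>z r. 0 < r \<Longrightarrow> cball z r \<subseteq> \<Omega> \<Longrightarrow>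
                  c * r ^ DIM('a) \<le> measure lebesgue (cball z r \<inter> limsup_set J R \<psi>)"
begin

lemma planes_nonempty: "\<alpha> \<in> J \<Longrightarrow> R \<alpha> \<noteq> {}"
  using planes[of \<alpha>] by auto

lemma \<psi>_power: "\<alpha> \<in> J \<Longrightarrow> \<psi> \<alpha> ^ m = g (\<Upsilon> \<alpha>)"
  using \<Upsilon>_nonneg[of \<alpha>] g_nonneg[of "\<Upsilon> \<alpha>"] g_zero m_pos
  by (cases "\<Upsilon> \<alpha> = 0") (auto simp: \<psi>_def)

lemma finite_large_\<psi>:
  assumes "0 < e"
  shows "finite {\<alpha>\<in>J. \<not> \<psi> \<alpha> \<le> e}"
proof -
  have "eventually (\<lambda>t. g t < e ^ m) (at_right 0)"
    using assms by (intro order_tendstoD(2)[OF g_lim]) simp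
  then obtain s where s: "0 < s" "\<And>t. 0 < t \<Longrightarrow> t < s \<Longrightarrow> g t < e ^ m"
    unfolding eventually_at_right_field by auto
  have "\<psi> \<alpha> \<le> e" if "\<alpha> \<in> J" "\<Upsilon> \<alpha> \<le> s / 2" for \<alpha>
  proof (rule ccontr)
    assume less: "\<not> \<psi> \<alpha> \<le> e"
    then have "e ^ m \<le> \<psi> \<alpha> ^ m" using assms by (intro power_mono) auto
    also have "\<dots> = g (\<Upsilon> \<alpha>)" using that(1) by (rule \<psi>_power)
    finally have "e ^ m \<le> g (\<Upsilon> \<alpha>)" .
    moreover have "g (\<Upsilon> \<alpha>) < e ^ m"
      using s(2)[of "\<Upsilon> \<alpha>"] s(1) that(2) \<Upsilon>_nonneg[OF that(1)] assms g_zero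
      by (cases "\<Upsilon> \<alpha> = 0") auto
    ultimately show False by simp
  qed
  then have "{\<alpha>\<in>J. \<not> \<psi> \<alpha> \<le> e} \<subseteq> {\<alpha>\<in>J. \<Upsilon> \<alpha> > s / 2}" by (auto simp: not_le[symmetric])
  then show ?thesis using \<Upsilon>_small[of "s / 2"] s(1) finite_subset by auto
qed

text \<open>
  Near \<open>0\<close> the gauge exceeds the power \<open>n\<close>, so \<open>g t \<ge> t ^ m\<close>.
\<close>
lemma finite_\<Upsilon>_gt_\<psi>: "finite {\<alpha>\<in>J. \<not> \<Upsilon> \<alpha> \<le> \<psi> \<alpha>}"
proof -
  obtain \<tau> where \<tau>: "0 < \<tau>" "\<And>t. 0 < t \<Longrightarrow> t \<le> \<tau> \<Longrightarrow> 1 * t ^ (m + l) \<le> f t"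
    using ratio_large[of 1] by blast
  have "\<Upsilon> \<alpha> \<le> \<psi> \<alpha>" if "\<alpha> \<in> J" "\<Upsilon> \<alpha> \<le> \<tau>" for \<alpha>
  proof (cases "\<Upsilon> \<alpha> = 0")
    case True
    then show ?thesis by (simp add: \<psi>_def g_zero)
  next
    case False
    then have pos: "0 < \<Upsilon> \<alpha>" using \<Upsilon>_nonneg[OF that(1)] by simp
    then have "\<Upsilon> \<alpha> ^ m * \<Upsilon> \<alpha> ^ l \<le> g (\<Upsilon> \<alpha>) * \<Upsilon> \<alpha> ^ l"
      using \<tau>(2)[OF pos that(2)] by (simp add: f_eq power_add)
    then have "\<Upsilon> \<alpha> ^ m \<le> \<psi> \<alpha> ^ m" using pos \<psi>_power[OF that(1)] by simp
    moreover have "0 \<le> \<psi> \<alpha>" using g_nonneg[OF pos] by (simp add: \<psi>_def real_root_ge_zero)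
    ultimately show ?thesis using m_pos pos by simp
  qed
  then have "{\<alpha>\<in>J. \<not> \<Upsilon> \<alpha> \<le> \<psi> \<alpha>} \<subseteq> {\<alpha>\<in>J. \<Upsilon> \<alpha> > \<tau>}" by (auto simp: not_le[symmetric])
  then show ?thesis using \<Upsilon>_small[OF \<tau>(1)] finite_subset by auto
qed

text \<open>
  \<open>\<beta>\<close> is the proportion, in powers of radii, that packings can fill; the factor \<open>20 ^ n\<close> comes from
  the half-ball and the enlargement by \<open>10\<close> in \<open>exists_packing\<close>.  With the admissible load
  \<open>\<epsilon>\<close>, the cover balls spoil at most half of the tile weight inside packing balls no larger
  than themselves, since a cover ball of radius \<open>t\<close> spoils at most \<open>(3 * t) ^ n\<close> there.
\<close>
definition \<beta> where "\<beta> = c / (2 * 20 ^ DIM('a) * unit_ball_vol (DIM('a)))"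
definition \<epsilon> where "\<epsilon> = \<beta> / (2 * 3 ^ DIM('a))"

lemma \<beta>_pos: "0 < \<beta>" and \<epsilon>_pos: "0 < \<epsilon>"
  using c_pos by (simp_all add: \<beta>_def \<epsilon>_def unit_ball_vol_pos)

lemma exists_large_packing:
  assumes "0 < r" "cball z r \<subseteq> \<Omega>" "finite F" and small: "\<And>\<alpha>. \<alpha> \<in> J - F \<Longrightarrow> \<psi> \<alpha> \<le> r / 4"
  obtains I where "packing (J - F) R \<psi> z r I" "\<beta> * r ^ DIM('a) < (\<Sum>i\<in>I. \<psi> (snd i) ^ DIM('a))"
proof -
  let ?\<omega> = "unit_ball_vol (DIM('a))"
  have "cball z (r / 2) \<subseteq> \<Omega>" using subset_cball[of "r / 2" r z] assms(1,2) by auto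
  then have "c * (r / 2) ^ DIM('a) \<le> measure lebesgue (cball z (r / 2) \<inter> limsup_set J R \<psi>)"
    using \<open>0 < r\<close> by (intro ample) auto
  moreover have "c * (r / 2) ^ DIM('a) / 2 < c * (r / 2) ^ DIM('a)"
    using c_pos \<open>0 < r\<close> by simp
  ultimately have meas: "c * (r / 2) ^ DIM('a) / 2 < measure lebesgue (cball z (r / 2) \<inter> limsup_set J R \<psi>)"
    by simp
  obtain I where I: "packing (J - F) R \<psi> z r I"
    "c * (r / 2) ^ DIM('a) / 2 < ?\<omega> * 10 ^ DIM('a) * (\<Sum>i\<in>I. \<psi> (snd i) ^ DIM('a))"
    by (rule exists_packing[OF planes_nonempty J assms(3) small meas])
  have eq: "?\<omega> * 10 ^ DIM('a) * (\<beta> * r ^ DIM('a)) = c * (r / 2) ^ DIM('a) / 2"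
  proof -
    have "(20::real) ^ DIM('a) = 10 ^ DIM('a) * 2 ^ DIM('a)" by (simp flip: power_mult_distrib)
    then show ?thesis by (simp add: \<beta>_def power_divide unit_ball_vol_pos[THEN less_imp_neq, symmetric] field_simps)
  qed
  have "?\<omega> * 10 ^ DIM('a) * (\<beta> * r ^ DIM('a)) < ?\<omega> * 10 ^ DIM('a) * (\<Sum>i\<in>I. \<psi> (snd i) ^ DIM('a))"
    using I(2) by (simp only: eq)
  moreover have "0 < ?\<omega> * 10 ^ DIM('a)" by simp
  ultimately have "\<beta> * r ^ DIM('a) < (\<Sum>i\<in>I. \<psi> (snd i) ^ DIM('a))"
    by (simp only: mult_less_cancel_left_pos)
  with I(1) show thesis by (rule that)
qed

text \<open>
  The inductive step of the construction, and the heart of the proof: the average of the damage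
  over all tiles, by all cover balls, is less than \<open>1\<close>, so it is less than \<open>1\<close> for some tile.  As
  the damage is cut off at \<open>1\<close>, the cut-off is then inactive for that tile, and the bound is
  precisely the bound on its load.
\<close>
lemma exists_lighter_ball:
  assumes r: "0 < r" "cball z r \<subseteq> \<Omega>" and F: "finite F"
    and C: "\<And>D. D \<in> C \<Longrightarrow> ball_with_radius (fst D) (snd D)"
    and sumf: "(\<integral>\<^sup>+D. ennreal (f (snd D)) \<partial>count_space C) < \<infinity>"
    and light: "load C (cball z r) \<le> ennreal (\<epsilon> * r ^ DIM('a))"
  shows "\<exists>z' r' \<alpha>. \<alpha> \<in> J - F \<and> 0 < r' \<and> r' \<le> r / 2 \<and> cball z' r' \<subseteq> cball z r
           \<and> cball z' r' \<subseteq> nbhd (R \<alpha>) (\<Upsilon> \<alpha>) \<and> load C (cball z' r') \<le> ennreal (\<epsilon> * r' ^ DIM('a))"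
proof -
  let ?n = "DIM('a)"
  define C1 where "C1 = (10 * real l) ^ l * (1 + 2 ^ ?n / \<epsilon>)"
  \<comment> \<open>The share of the tile weight left for the cover balls of radius at most \<open>\<tau>\<close> is one half, and \<open>C1\<close> is the constant of \<open>plane_tiles\<close>; adding \<open>1\<close> only keeps the denominator positive.\<close>
  define \<eta> where "\<eta> = \<beta> * r ^ ?n / (2 * (C1 + 1))"
  have C1: "0 \<le> C1" using \<epsilon>_pos by (simp add: C1_def)
  have \<eta>: "0 < \<eta>" using C1 \<beta>_pos r by (simp add: \<eta>_def)
  have posC: "0 < snd D" if "D \<in> C" for D using C[OF that] by (simp add: ball_with_radius_def)
  obtain \<tau> where \<tau>: "0 < \<tau>"
    "(\<integral>\<^sup>+D. ennreal (f (snd D)) * indicator {D. snd D \<le> \<tau>} D \<partial>count_space C) < ennreal \<eta>"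
    by (rule cover_tail_small[OF sumf posC \<eta>])
  \<comment> \<open>The excluded indices ensure that the packing balls are no larger than \<open>\<tau>\<close> and that the tiles fit into them.\<close>
  define F' where "F' = F \<union> {\<alpha>\<in>J. \<not> \<psi> \<alpha> \<le> min (r / 4) \<tau>} \<union> {\<alpha>\<in>J. \<not> \<Upsilon> \<alpha> \<le> \<psi> \<alpha>}"
  have finF': "finite F'"
    using F finite_large_\<psi>[of "min (r / 4) \<tau>"] finite_\<Upsilon>_gt_\<psi> r \<tau>(1) by (simp add: F'_def)
  have outF': "\<psi> \<alpha> \<le> r / 4" "\<psi> \<alpha> \<le> \<tau>" "\<Upsilon> \<alpha> \<le> \<psi> \<alpha>" "\<alpha> \<in> J - F" if "\<alpha> \<in> J - F'" for \<alpha>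
    using that by (auto simp: F'_def)
  obtain I where I: "packing (J - F') R \<psi> z r I" "\<beta> * r ^ ?n < (\<Sum>i\<in>I. \<psi> (snd i) ^ ?n)"
    by (rule exists_large_packing[OF r finF' outF'(1)])
  have finI: "finite I" using I by (simp add: packing_def)
  have i: "snd i \<in> J - F'" "fst i \<in> R (snd i)" "0 < \<psi> (snd i)" "cball (fst i) (\<psi> (snd i)) \<subseteq> cball z r"
    if "i \<in> I" for i
    using I(1) that by (auto simp: packing_def case_prod_unfold)
  have iJ: "snd i \<in> J" if "i \<in> I" for i using i(1)[OF that] by simp
  have u: "0 < \<Upsilon> (snd i)" if "i \<in> I" for i
    using \<Upsilon>_nonneg[OF iJ[OF that]] i(3)[OF that] g_zero by (cases "\<Upsilon> (snd i) = 0") (auto simp: \<psi>_def)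
  let ?cnt = "\<lambda>P i y t. real (card {p\<in>P. dist p y \<le> t + \<Upsilon> (snd i) / 2})"
  let ?cap = "\<lambda>i t. min 1 (t ^ ?n / (\<epsilon> * (\<Upsilon> (snd i) / 2) ^ ?n))"
  define tiles where "tiles i P \<longleftrightarrow> finite P \<and> P \<noteq> {} \<and> P \<subseteq> R (snd i) \<inter> cball (fst i) (\<psi> (snd i) / 2) \<and>
      (\<forall>y t. 0 < t \<longrightarrow> \<psi> (snd i) ^ ?n / card P * (?cnt P i y t * ?cap i t) \<le> C1 * f t)" for i P
  have "\<exists>P. tiles i P" if iI: "i \<in> I" for i
  proof -
    have pl: "affine (R (snd i))" "aff_dim (R (snd i)) = int l" using planes[OF iJ[OF iI]] by auto
    note pl_tiles = plane_tiles[OF dim pl i(2)[OF iI] u[OF iI] outF'(3)[OF i(1)[OF iI]] \<psi>_power[OF iJ[OF iI]] \<epsilon>_pos]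
    show ?thesis
    proof (rule pl_tiles)
      fix P assume "finite P" "P \<noteq> {}" "P \<subseteq> R (snd i) \<inter> cball (fst i) (\<psi> (snd i) / 2)"
        "\<And>y t. 0 < t \<Longrightarrow> \<psi> (snd i) ^ ?n / card P * (?cnt P i y t * ?cap i t)
            \<le> (10 * real l) ^ l * (1 + 2 ^ ?n / \<epsilon>) * f t"
      then have "tiles i P" by (simp add: tiles_def C1_def)
      then show "\<exists>P. tiles i P" ..
    qed
  qed
  then obtain P where "\<And>i. i \<in> I \<Longrightarrow> tiles i (P i)" by metis
  then have P: "\<And>i. i \<in> I \<Longrightarrow> finite (P i)" "\<And>i. i \<in> I \<Longrightarrow> P i \<noteq> {}"
    "\<And>i. i \<in> I \<Longrightarrow> P i \<subseteq> R (snd i) \<inter> cball (fst i) (\<psi> (snd i) / 2)"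
    "\<And>i y t. i \<in> I \<Longrightarrow> 0 < t \<Longrightarrow>
       \<psi> (snd i) ^ ?n / card (P i) * (?cnt (P i) i y t * ?cap i t) \<le> C1 * f t"
    unfolding tiles_def by blast+
  have cP: "0 < real (card (P i))" if "i \<in> I" for i using P(1,2)[OF that] by (simp add: card_gt_0_iff)
  define K where "K i q = cball q (\<Upsilon> (snd i) / 2)" for i :: "'a \<times> 'j" and q :: 'a
  define W where "W i = \<psi> (snd i) ^ ?n / card (P i)" for i :: "'a \<times> 'j"
  define cost where "cost i q D = (if fst D \<inter> K i q = {} then 0 else ?cap i (snd D))" for i :: "'a \<times> 'j" and q and D :: "'a set \<times> real"
  have W0: "0 \<le> W i" if "i \<in> I" for i using i(3)[OF that] by (simp add: W_def)
  have cost01: "0 \<le> cost i q D" "cost i q D \<le> 1" if "i \<in> I" "D \<in> C" for i q D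
    using \<epsilon>_pos u[OF that(1)] posC[OF that(2)] by (auto simp: cost_def)
  have Ksub: "K i q \<subseteq> cball (fst i) (\<psi> (snd i))" if "i \<in> I" "q \<in> P i" for i q
  proof
    fix x assume "x \<in> K i q"
    moreover have "dist (fst i) q \<le> \<psi> (snd i) / 2" using P(3)[OF that(1)] that(2) by auto
    ultimately show "x \<in> cball (fst i) (\<psi> (snd i))"
      using outF'(3)[OF i(1)[OF that(1)]] dist_triangle[of "fst i" x q] by (simp add: K_def)
  qed
  \<comment> \<open>The first summand comes from packing balls no larger than \<open>D\<close>, the second from the at most one larger packing ball that \<open>D\<close> affects; the latter exists only if \<open>snd D \<le> \<tau>\<close>.\<close>
  have cover_cost: "(\<Sum>i\<in>I. \<Sum>q\<in>P i. W i * cost i q D)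
      \<le> 3 ^ ?n * (snd D ^ ?n * indicator {D. fst D \<inter> cball z r \<noteq> {}} D)
         + C1 * (f (snd D) * indicator {D. snd D \<le> \<tau>} D)" (is "?S \<le> _") if D: "D \<in> C" for D
  proof (cases "fst D \<inter> cball z r = {}")
    case True
    have "cost i q D = 0" if "i \<in> I" "q \<in> P i" for i q
      using True Ksub[OF that] i(4)[OF that(1)] by (auto simp: cost_def)
    then have "?S = 0" by simp
    then show ?thesis using True C1 f_nonneg[OF posC[OF D]] by simp
  next
    case False
    define t where "t = snd D"
    have t: "0 < t" using posC[OF D] by (simp add: t_def)
    obtain y where y: "fst D = ball y t \<or> fst D = cball y t"
      using C[OF D] by (auto simp: ball_with_radius_def t_def)
    have hit: "dist q y \<le> t + \<Upsilon> (snd i) / 2" if "fst D \<inter> K i q \<noteq> {}" for i q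
    proof -
      obtain x where "x \<in> fst D" "x \<in> K i q" using \<open>fst D \<inter> K i q \<noteq> {}\<close> by blast
      then have "dist y x \<le> t" "dist q x \<le> \<Upsilon> (snd i) / 2" using y by (auto simp: K_def)
      then show ?thesis using dist_triangle3[of q y x] by (simp add: dist_commute)
    qed
    have "?S \<le> (3 * t) ^ ?n + (if \<exists>i\<in>I. t < \<psi> (snd i) then C1 * f t else 0)"
    proof (rule packing_hit_le[OF I(1) t])
      show "0 \<le> C1 * f t" using C1 f_nonneg[OF t] by simp
      fix i assume iI: "i \<in> I"
      show "0 \<le> (\<Sum>q\<in>P i. W i * cost i q D)"
        using W0[OF iI] cost01[OF iI D] by (intro sum_nonneg mult_nonneg_nonneg) auto
      have "(\<Sum>q\<in>P i. W i * cost i q D) \<le> (\<Sum>q\<in>P i. W i * 1)"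
        using W0[OF iI] cost01[OF iI D] by (intro sum_mono mult_left_mono) auto
      also have "\<dots> = \<psi> (snd i) ^ ?n" using cP[OF iI] by (simp add: W_def)
      finally show "(\<Sum>q\<in>P i. W i * cost i q D) \<le> \<psi> (snd i) ^ ?n" .
      have "(\<Sum>q\<in>P i. W i * cost i q D) \<le> (\<Sum>q\<in>P i. if dist q y \<le> t + \<Upsilon> (snd i) / 2 then W i * ?cap i t else 0)"
        using W0[OF iI] hit \<epsilon>_pos u[OF iI] t by (intro sum_mono) (auto simp: cost_def t_def)
      also have "\<dots> = (\<Sum>q\<in>{q\<in>P i. dist q y \<le> t + \<Upsilon> (snd i) / 2}. W i * ?cap i t)"
        using P(1)[OF iI] by (rule sum.inter_filter[symmetric])
      also have "\<dots> = W i * (?cnt (P i) i y t * ?cap i t)" by simp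
      also have "\<dots> \<le> C1 * f t" unfolding W_def by (rule P(4)[OF iI t])
      finally show "(\<Sum>q\<in>P i. W i * cost i q D) \<le> C1 * f t" .
      assume "(\<Sum>q\<in>P i. W i * cost i q D) \<noteq> 0"
      then obtain q where q: "q \<in> P i" "cost i q D \<noteq> 0"
        by (metis (no_types, lifting) mult_zero_right sum.neutral)
      then have "dist q y \<le> t + \<Upsilon> (snd i) / 2" using hit by (auto simp: cost_def split: if_splits)
      moreover have "dist (fst i) q \<le> \<psi> (snd i) / 2" using P(3)[OF iI] q(1) by auto
      ultimately show "dist (fst i) y \<le> t + \<psi> (snd i)"
        using outF'(3)[OF i(1)[OF iI]] dist_triangle[of "fst i" y q] by simp
    qed
    also have "\<dots> \<le> 3 ^ ?n * t ^ ?n + C1 * (f t * indicator {D. snd D \<le> \<tau>} D)"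
    proof -
      have "t \<le> \<tau>" if "i \<in> I" "t < \<psi> (snd i)" for i
        using outF'(2)[OF i(1)[OF that(1)]] that(2) by simp
      then show ?thesis using C1 f_nonneg[OF t]
        by (auto simp: power_mult_distrib t_def indicator_def)
    qed
    finally show ?thesis using False by (simp add: t_def)
  qed
  define S where "S i q = (\<integral>\<^sup>+D. ennreal (cost i q D) \<partial>count_space C)" for i :: "'a \<times> 'j" and q
  have "(\<Sum>i\<in>I. \<Sum>q\<in>P i. ennreal (W i) * S i q)
      = (\<integral>\<^sup>+D. (\<Sum>i\<in>I. \<Sum>q\<in>P i. ennreal (W i) * ennreal (cost i q D)) \<partial>count_space C)"
    by (simp add: S_def nn_integral_sum nn_integral_cmult)
  also have "\<dots> = (\<integral>\<^sup>+D. ennreal (\<Sum>i\<in>I. \<Sum>q\<in>P i. W i * cost i q D) \<partial>count_space C)"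
    using W0 cost01
    by (intro nn_integral_cong) (simp add: ennreal_mult[symmetric] sum_ennreal sum_nonneg)
  also have "\<dots> \<le> (\<integral>\<^sup>+D. ennreal (3 ^ ?n) * (ennreal (snd D ^ ?n) * indicator {D. fst D \<inter> cball z r \<noteq> {}} D)
         + ennreal C1 * (ennreal (f (snd D)) * indicator {D. snd D \<le> \<tau>} D) \<partial>count_space C)"
  proof (rule nn_integral_mono)
    fix D assume "D \<in> space (count_space C)"
    then have D: "D \<in> C" by simp
    have eq: "ennreal v * indicator A D = ennreal (v * indicator A D)" for v and A :: "('a set \<times> real) set"
      by (simp add: indicator_def)
    show "ennreal (\<Sum>i\<in>I. \<Sum>q\<in>P i. W i * cost i q D)
       \<le> ennreal (3 ^ ?n) * (ennreal (snd D ^ ?n) * indicator {D. fst D \<inter> cball z r \<noteq> {}} D)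
         + ennreal C1 * (ennreal (f (snd D)) * indicator {D. snd D \<le> \<tau>} D)"
      using cover_cost[OF D] C1 posC[OF D] f_nonneg[OF posC[OF D]]
      by (simp add: eq ennreal_mult[symmetric] ennreal_plus[symmetric] ennreal_leI del: ennreal_plus)
  qed
  also have "\<dots> = ennreal (3 ^ ?n) * load C (cball z r)
      + ennreal C1 * (\<integral>\<^sup>+D. ennreal (f (snd D)) * indicator {D. snd D \<le> \<tau>} D \<partial>count_space C)"
    by (simp add: nn_integral_add nn_integral_cmult load_def)
  also have "\<dots> \<le> ennreal (3 ^ ?n) * ennreal (\<epsilon> * r ^ ?n) + ennreal C1 * ennreal \<eta>"
    using light \<tau>(2) by (intro add_mono mult_left_mono) auto
  also have "\<dots> = ennreal (3 ^ ?n * (\<epsilon> * r ^ ?n) + C1 * \<eta>)"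
    using C1 \<eta> \<epsilon>_pos r by (simp add: ennreal_mult ennreal_plus)
  also have "\<dots> \<le> ennreal (\<beta> * r ^ ?n)"
  proof (rule ennreal_leI)
    have "3 ^ ?n * (\<epsilon> * r ^ ?n) = \<beta> * r ^ ?n / 2" by (simp add: \<epsilon>_def)
    moreover have "C1 * \<eta> \<le> (C1 + 1) * \<eta>" using \<eta> by simp
    moreover have "(C1 + 1) * \<eta> = \<beta> * r ^ ?n / 2"
    proof -
      have "C1 + 1 \<noteq> 0" using C1 by simp
      then show ?thesis by (simp add: \<eta>_def del: distrib_left_numeral)
    qed
    ultimately show "3 ^ ?n * (\<epsilon> * r ^ ?n) + C1 * \<eta> \<le> \<beta> * r ^ ?n" by linarith
  qed
  also have "\<dots> < ennreal (\<Sum>i\<in>I. \<psi> (snd i) ^ ?n)"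
    using I(2) \<beta>_pos r by (simp add: ennreal_less_iff)
  also have "(\<Sum>i\<in>I. \<psi> (snd i) ^ ?n) = (\<Sum>i\<in>I. \<Sum>q\<in>P i. W i)"
    using cP by (intro sum.cong) (auto simp: W_def)
  finally have total: "(\<Sum>i\<in>I. \<Sum>q\<in>P i. ennreal (W i) * S i q) < ennreal (\<Sum>i\<in>I. \<Sum>q\<in>P i. W i)" .
  \<comment> \<open>Otherwise the weighted total damage would be at least the total weight.\<close>
  have "\<exists>i\<in>I. \<exists>q\<in>P i. S i q < 1"
  proof (rule ccontr)
    assume "\<not> ?thesis"
    then have "1 \<le> S i q" if "i \<in> I" "q \<in> P i" for i q using that by (auto simp: not_less)
    then have "(\<Sum>i\<in>I. \<Sum>q\<in>P i. ennreal (W i) * 1) \<le> (\<Sum>i\<in>I. \<Sum>q\<in>P i. ennreal (W i) * S i q)"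
      by (intro sum_mono mult_left_mono) auto
    moreover have "(\<Sum>i\<in>I. \<Sum>q\<in>P i. ennreal (W i) * 1) = ennreal (\<Sum>i\<in>I. \<Sum>q\<in>P i. W i)"
      using W0 by (simp add: sum_ennreal sum_nonneg del: sum_constant)
    ultimately show False using total by simp
  qed
  then obtain i q where iq: "i \<in> I" "q \<in> P i" "S i q < 1" by blast
  define r' where "r' = \<Upsilon> (snd i) / 2"
  have r': "0 < r'" using u[OF iq(1)] by (simp add: r'_def)
  have K: "K i q = cball q r'" by (simp add: K_def r'_def)
  have cost_lt: "cost i q D < 1" if "D \<in> C" for D
  proof -
    have "ennreal (cost i q D) \<le> S i q" unfolding S_def using that by (rule nn_integral_ge_point)
    then have "ennreal (cost i q D) < ennreal 1"
      using iq(3) unfolding ennreal_1 by (rule le_less_trans)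
    then show ?thesis using cost01(1)[OF iq(1) that] by (simp only: ennreal_less_iff)
  qed
  have "load C (cball q r') = (\<integral>\<^sup>+D. ennreal (\<epsilon> * r' ^ ?n) * ennreal (cost i q D) \<partial>count_space C)"
    unfolding load_def
  proof (rule nn_integral_cong)
    fix D assume "D \<in> space (count_space C)"
    then have D: "D \<in> C" by simp
    show "ennreal (snd D ^ ?n) * indicator {D. fst D \<inter> cball q r' \<noteq> {}} D = ennreal (\<epsilon> * r' ^ ?n) * ennreal (cost i q D)"
    proof (cases "fst D \<inter> K i q = {}")
      case True
      then show ?thesis by (simp add: cost_def K)
    next
      case False
      then have "cost i q D = snd D ^ ?n / (\<epsilon> * r' ^ ?n)"
        using cost_lt[OF D] by (auto simp: cost_def r'_def min_def split: if_splits)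
      then have "\<epsilon> * r' ^ ?n * cost i q D = snd D ^ ?n" using \<epsilon>_pos r' by simp
      then show ?thesis
        using False \<epsilon>_pos r' cost01(1)[OF iq(1) D] by (simp add: K ennreal_mult[symmetric])
    qed
  qed
  also have "\<dots> = ennreal (\<epsilon> * r' ^ ?n) * S i q" by (simp add: S_def nn_integral_cmult)
  also have "\<dots> \<le> ennreal (\<epsilon> * r' ^ ?n) * 1" using iq(3) by (intro mult_left_mono) auto
  finally have "load C (cball q r') \<le> ennreal (\<epsilon> * r' ^ ?n)" by simp
  moreover have "snd i \<in> J - F" using outF'(4)[OF i(1)[OF iq(1)]] .
  moreover have "r' \<le> r / 2"
    using outF'(1,3)[OF i(1)[OF iq(1)]] r by (simp add: r'_def)
  moreover have "cball q r' \<subseteq> cball z r" using Ksub[OF iq(1,2)] i(4)[OF iq(1)] by (simp add: K)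
  moreover have "cball q r' \<subseteq> nbhd (R (snd i)) (\<Upsilon> (snd i))"
  proof
    fix x assume "x \<in> cball q r'"
    moreover have "q \<in> R (snd i)" using P(3)[OF iq(1)] iq(2) by auto
    ultimately have "infdist x (R (snd i)) \<le> r'" by (intro infdist_le2) (auto simp: dist_commute)
    then show "x \<in> nbhd (R (snd i)) (\<Upsilon> (snd i))" using r' by (simp add: nbhd_def r'_def)
  qed
  ultimately show ?thesis using r' by blast
qed

text \<open>
  Iterating the step with \<open>F\<close> the set of indices already used gives nested balls whose common point
  lies in the neighbourhoods of infinitely many planes.  A cover ball of radius \<open>t\<close> containing that
  point would meet all the nested balls, so \<open>t ^ n\<close> would be bounded by loads that tend to \<open>0\<close>.
\<close>
lemma limsup_set_not_covered:
  assumes r0: "0 < r0" "cball z0 r0 \<subseteq> \<Omega>"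
    and C: "\<And>D. D \<in> C \<Longrightarrow> ball_with_radius (fst D) (snd D)"
    and sumf: "(\<integral>\<^sup>+D. ennreal (f (snd D)) \<partial>count_space C) < \<infinity>"
    and light: "load C (cball z0 r0) \<le> ennreal (\<epsilon> * r0 ^ DIM('a))"
  shows "\<not> cball z0 r0 \<inter> limsup_set J R \<Upsilon> \<subseteq> (\<Union>D\<in>C. fst D)"
proof -
  let ?n = "DIM('a)"
  define good where "good k s \<longleftrightarrow> (case s of (z, r, F) \<Rightarrow> 0 < r \<and> cball z r \<subseteq> cball z0 r0 \<and> finite F
      \<and> card F = k \<and> r \<le> r0 / 2 ^ k \<and> load C (cball z r) \<le> ennreal (\<epsilon> * r ^ ?n))"
    for k and s :: "'a \<times> real \<times> 'j set"
  define step where "step s s' \<longleftrightarrow> (case s of (z, r, F) \<Rightarrow> case s' of (z', r', F') \<Rightarrow>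
      cball z' r' \<subseteq> cball z r \<and> (\<exists>\<alpha>\<in>J - F. F' = insert \<alpha> F \<and> cball z' r' \<subseteq> nbhd (R \<alpha>) (\<Upsilon> \<alpha>)))"
    for s s' :: "'a \<times> real \<times> 'j set"
  have start: "good 0 (z0, r0, {})" using r0 light by (simp add: good_def)
  have "\<exists>s'. good (Suc k) s' \<and> step s s'" if "good k s" for k s
  proof -
    obtain z r F where s: "s = (z, r, F)" by (cases s)
    then have g: "0 < r" "cball z r \<subseteq> cball z0 r0" "finite F" "card F = k" "r \<le> r0 / 2 ^ k"
      "load C (cball z r) \<le> ennreal (\<epsilon> * r ^ ?n)"
      using that by (simp_all add: good_def)
    obtain z' r' \<alpha> where n: "\<alpha> \<in> J - F" "0 < r'" "r' \<le> r / 2" "cball z' r' \<subseteq> cball z r"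
      "cball z' r' \<subseteq> nbhd (R \<alpha>) (\<Upsilon> \<alpha>)" "load C (cball z' r') \<le> ennreal (\<epsilon> * r' ^ ?n)"
      using exists_lighter_ball[OF g(1) order_trans[OF g(2) r0(2)] g(3) C sumf g(6)] by blast
    have "r' \<le> r0 / 2 ^ Suc k" using n(3) g(5) by simp
    then have "good (Suc k) (z', r', insert \<alpha> F)"
      using n g by (simp add: good_def card_insert_disjoint del: power_Suc)
    moreover have "step s (z', r', insert \<alpha> F)" using n s by (auto simp: step_def)
    ultimately show ?thesis by blast
  qed
  then have "\<exists>S. \<forall>k. good k (S k) \<and> step (S k) (S (Suc k))"
    using start by (intro dependent_nat_choice) auto
  then obtain S where S: "\<And>k. good k (S k)" "\<And>k. step (S k) (S (Suc k))" by blast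
  define B where "B k = cball (fst (S k)) (fst (snd (S k)))" for k
  define r where "r k = fst (snd (S k))" for k
  have Bsub: "B k \<subseteq> cball z0 r0" for k
    using S(1)[of k] by (auto simp: good_def B_def case_prod_unfold)
  have r: "0 < r k" "r k \<le> r0 / 2 ^ k" "load C (B k) \<le> ennreal (\<epsilon> * r k ^ ?n)" for k
    using S(1)[of k] by (auto simp: good_def r_def B_def case_prod_unfold)
  have F: "finite (snd (snd (S k)))" "card (snd (snd (S k))) = k" for k
    using S(1)[of k] by (auto simp: good_def case_prod_unfold)
  have B: "B (Suc k) \<subseteq> B k" "\<exists>\<alpha>\<in>J. snd (snd (S (Suc k))) = insert \<alpha> (snd (snd (S k)))
      \<and> B (Suc k) \<subseteq> nbhd (R \<alpha>) (\<Upsilon> \<alpha>)" for k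
    using S(2)[of k] by (auto simp: step_def B_def case_prod_unfold)
  have dec: "B j \<subseteq> B k" if "k \<le> j" for j k
    using decseqD[OF decseq_SucI[of B, OF B(1)] that] .
  have "\<Inter> (range B) \<noteq> {}"
  proof (rule compact_nest)
    show "\<And>k. compact (B k)" by (simp add: B_def)
    show "\<And>k. B k \<noteq> {}" using r(1) by (simp add: B_def r_def not_less less_imp_le)
  qed (rule dec)
  then obtain x where x: "\<And>k. x \<in> B k" by blast
  have sub: "snd (snd (S k)) - snd (snd (S 0)) \<subseteq> {\<alpha>\<in>J. x \<in> nbhd (R \<alpha>) (\<Upsilon> \<alpha>)}" for k
  proof (induction k)
    case (Suc k)
    then show ?case using B(2)[of k] x[of "Suc k"] by auto
  qed simp
  have "snd (snd (S 0)) = {}" using F[of 0] by simp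
  with sub have sub: "snd (snd (S k)) \<subseteq> {\<alpha>\<in>J. x \<in> nbhd (R \<alpha>) (\<Upsilon> \<alpha>)}" for k by simp
  have inf: "infinite {\<alpha>\<in>J. x \<in> nbhd (R \<alpha>) (\<Upsilon> \<alpha>)}" (is "infinite ?A")
  proof
    assume "finite ?A"
    then have "card (snd (snd (S (Suc (card ?A))))) \<le> card ?A" by (rule card_mono[OF _ sub])
    then show False using F(2) by simp
  qed
  show ?thesis
  proof
    assume cov: "cball z0 r0 \<inter> limsup_set J R \<Upsilon> \<subseteq> (\<Union>D\<in>C. fst D)"
    have "x \<in> cball z0 r0 \<inter> limsup_set J R \<Upsilon>"
      using inf subsetD[OF Bsub x[of 0]] by (simp add: limsup_set_def)
    then obtain D where D: "D \<in> C" "x \<in> fst D" using cov by blast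
    have t: "0 < snd D" using C[OF D(1)] by (simp add: ball_with_radius_def)
    have "snd D ^ ?n \<le> \<epsilon> * (r0 / 2 ^ k) ^ ?n" for k
    proof -
      have "fst D \<inter> B k \<noteq> {}" using D(2) x by blast
      then have "ennreal (snd D ^ ?n) = ennreal (snd D ^ ?n) * indicator {D. fst D \<inter> B k \<noteq> {}} D"
        by simp
      also have "\<dots> \<le> load C (B k)" unfolding load_def by (rule nn_integral_ge_point[OF D(1)])
      also have "\<dots> \<le> ennreal (\<epsilon> * r k ^ ?n)" by (rule r(3))
      finally have "snd D ^ ?n \<le> \<epsilon> * r k ^ ?n"
        using \<epsilon>_pos r(1)[of k] by (simp add: ennreal_le_iff)
      also have "\<dots> \<le> \<epsilon> * (r0 / 2 ^ k) ^ ?n"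
        using \<epsilon>_pos r(1,2)[of k] by (intro mult_left_mono power_mono) auto
      finally show ?thesis .
    qed
    moreover have "(\<lambda>k. \<epsilon> * (r0 / 2 ^ k) ^ ?n) \<longlonglongrightarrow> \<epsilon> * 0 ^ ?n"
      by (intro tendsto_intros LIMSEQ_divide_realpow_zero) simp
    ultimately have "snd D ^ ?n \<le> \<epsilon> * 0 ^ ?n" by (intro LIMSEQ_le_const) auto
    moreover have "0 < snd D ^ ?n" using t by simp
    ultimately show False by (simp add: power_0_left)
  qed
qed

text \<open>
  If all radii of a cover are so small that \<open>f t \<ge> A * t ^ n\<close>, the load of any ball is at most
  the sum of the \<open>f t\<close> divided by \<open>A\<close>.  This starts the construction at \<open>cball z0 r0\<close>.
\<close>
lemma hausdorff_measure_limsup_set_eq_infinity: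
  assumes "0 < r0" "cball z0 r0 \<subseteq> \<Omega>"
  shows "hausdorff_measure f (cball z0 r0 \<inter> limsup_set J R \<Upsilon>) = \<infinity>"
proof (rule ccontr)
  let ?E = "cball z0 r0 \<inter> limsup_set J R \<Upsilon>" and ?n = "DIM('a)"
  assume "hausdorff_measure f ?E \<noteq> \<infinity>"
  then have "hausdorff_measure f ?E < top" by (simp add: less_top)
  then obtain T where T: "0 \<le> T" "hausdorff_measure f ?E = ennreal T"
    by (metis ennreal_cases less_irrefl)
  define A where "A = (T + 1) / (\<epsilon> * r0 ^ ?n)"
  have A: "0 < A" using T(1) \<epsilon>_pos assms(1) by (simp add: A_def)
  obtain \<rho> where \<rho>: "0 < \<rho>" "\<And>t. 0 < t \<Longrightarrow> t \<le> \<rho> \<Longrightarrow> A * t ^ (m + l) \<le> f t"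
    using ratio_large[of A] by blast
  have "hausdorff_premeasure f \<rho> ?E < ennreal (T + 1)"
    using hausdorff_premeasure_le_measure[OF \<rho>(1), of f ?E] T by (auto simp: ennreal_less_iff intro: le_less_trans)
  then obtain C where C: "fine_cover \<rho> ?E C" "(\<integral>\<^sup>+D. ennreal (f (snd D)) \<partial>count_space C) < ennreal (T + 1)"
    by (rule hausdorff_premeasure_approx)
  have ball: "ball_with_radius (fst D) (snd D)" "snd D \<le> \<rho>" if "D \<in> C" for D
    using C(1) that by (auto simp: fine_cover_def)
  have "ennreal A * load C (cball z0 r0) \<le> (\<integral>\<^sup>+D. ennreal A * ennreal (snd D ^ ?n) \<partial>count_space C)"
    unfolding load_def nn_integral_cmult[of _ "count_space C", simplified]
    by (intro mult_left_mono nn_integral_mono) (auto simp: indicator_def)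
  also have "\<dots> \<le> (\<integral>\<^sup>+D. ennreal (f (snd D)) \<partial>count_space C)"
  proof (rule nn_integral_mono)
    fix D assume "D \<in> space (count_space C)"
    then have D: "D \<in> C" by simp
    have "0 < snd D" using ball(1)[OF D] by (simp add: ball_with_radius_def)
    then show "ennreal A * ennreal (snd D ^ ?n) \<le> ennreal (f (snd D))"
      using \<rho>(2)[of "snd D"] ball(2)[OF D] A by (simp add: dim ennreal_mult[symmetric] ennreal_leI)
  qed
  also have "\<dots> \<le> ennreal (T + 1)" using C(2) by simp
  also have "ennreal (T + 1) = ennreal A * ennreal (\<epsilon> * r0 ^ ?n)"
    using A \<epsilon>_pos assms(1) by (simp add: ennreal_mult[symmetric] A_def)
  finally have light: "load C (cball z0 r0) \<le> ennreal (\<epsilon> * r0 ^ ?n)"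
    using A by (simp add: ennreal_mult_le_mult_iff)
  have fin: "(\<integral>\<^sup>+D. ennreal (f (snd D)) \<partial>count_space C) < \<infinity>"
    using C(2) by (rule less_le_trans) simp
  have "\<not> ?E \<subseteq> (\<Union>D\<in>C. fst D)"
    by (rule limsup_set_not_covered[OF assms ball(1) fin light])
  then show False using C(1) by (simp add: fine_cover_def)
qed

end

section \<open>Transference\<close>

text \<open>
  From \<open>f t \<le> C * t ^ n\<close> follows \<open>g t \<le> C * t ^ m\<close>, and so \<open>root m (g (\<Upsilon> \<alpha>))\<close> is at most a constant times
  \<open>\<Upsilon> \<alpha>\<close> whenever \<open>\<Upsilon> \<alpha> \<le> 1\<close>: the fat neighbourhoods are not much larger than the thin ones.
\<close>
lemma hausdorff_measure_diff_limsup_set_eq_0: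
  fixes R :: "'j \<Rightarrow> 'a::euclidean_space set"
  assumes dim: "DIM('a) = m + l" and "1 \<le> m" and J: "countable J"
    and ne: "\<And>\<alpha>. \<alpha> \<in> J \<Longrightarrow> R \<alpha> \<noteq> {}"
    and \<Upsilon>: "\<And>\<alpha>. \<alpha> \<in> J \<Longrightarrow> 0 \<le> \<Upsilon> \<alpha>" "\<And>e. 0 < e \<Longrightarrow> finite {\<alpha>\<in>J. \<Upsilon> \<alpha> > e}"
    and fg: "\<And>t. 0 < t \<Longrightarrow> f t = g t * t ^ l" and "g 0 = 0"
    and "0 \<le> C" and f_le: "\<And>t. 0 < t \<Longrightarrow> t \<le> 1 \<Longrightarrow> f t \<le> C * t ^ DIM('a)"
    and "0 < c" and ample: "\<And>z r. 0 < r \<Longrightarrow> cball z r \<subseteq> ball x s \<Longrightarrow>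
        c * r ^ DIM('a) \<le> measure lebesgue (cball z r \<inter> limsup_set J R (\<lambda>\<alpha>. root m (g (\<Upsilon> \<alpha>))))"
  shows "hausdorff_measure f (cball x s - limsup_set J R \<Upsilon>) = 0"
proof -
  let ?\<omega> = "unit_ball_vol (DIM('a))" and ?n = "DIM('a)"
  let ?L = "limsup_set J R \<Upsilon>"
  define \<psi> where "\<psi> \<alpha> = root m (g (\<Upsilon> \<alpha>))" for \<alpha>
  define \<kappa> where "\<kappa> = max 1 (root m C)"
  have \<kappa>: "1 \<le> \<kappa>" by (simp add: \<kappa>_def)
  have \<psi>_le: "\<psi> \<alpha> \<le> \<kappa> * \<Upsilon> \<alpha>" if "\<alpha> \<in> J" "\<Upsilon> \<alpha> \<le> 1" for \<alpha>
  proof (cases "\<Upsilon> \<alpha> = 0")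
    case True
    then show ?thesis by (simp add: \<psi>_def \<open>g 0 = 0\<close>)
  next
    case False
    then have pos: "0 < \<Upsilon> \<alpha>" using \<Upsilon>(1)[OF that(1)] by simp
    have "g (\<Upsilon> \<alpha>) * \<Upsilon> \<alpha> ^ l \<le> C * \<Upsilon> \<alpha> ^ m * \<Upsilon> \<alpha> ^ l"
      using f_le[OF pos that(2)] fg[OF pos] by (simp add: dim power_add mult.assoc)
    then have "g (\<Upsilon> \<alpha>) \<le> C * \<Upsilon> \<alpha> ^ m" using pos by simp
    then have "\<psi> \<alpha> \<le> root m (C * \<Upsilon> \<alpha> ^ m)" using \<open>1 \<le> m\<close> by (simp add: \<psi>_def)
    also have "\<dots> = root m C * \<Upsilon> \<alpha>"
      using \<open>1 \<le> m\<close> pos by (simp add: real_root_mult real_root_power_cancel)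
    also have "\<dots> \<le> \<kappa> * \<Upsilon> \<alpha>" using pos by (intro mult_right_mono) (auto simp: \<kappa>_def)
    finally show ?thesis .
  qed
  have fin\<kappa>: "finite {\<alpha>\<in>J. \<not> \<psi> \<alpha> \<le> \<kappa> * \<Upsilon> \<alpha>}"
    by (rule finite_subset[OF _ \<Upsilon>(2)[of 1]]) (use \<psi>_le in force)+
  have small: "finite {\<alpha>\<in>J. \<not> \<psi> \<alpha> \<le> e}" if "0 < e" for e
  proof (rule finite_subset)
    show "finite {\<alpha>\<in>J. \<Upsilon> \<alpha> > min 1 (e / \<kappa>)}" using that \<kappa> by (intro \<Upsilon>(2)) auto
    have "\<psi> \<alpha> \<le> e" if "\<alpha> \<in> J" "\<Upsilon> \<alpha> \<le> min 1 (e / \<kappa>)" for \<alpha>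
    proof -
      have "\<psi> \<alpha> \<le> \<kappa> * \<Upsilon> \<alpha>" using that by (intro \<psi>_le) auto
      also have "\<dots> \<le> e" using that(2) \<kappa> by (simp add: le_divide_eq mult.commute)
      finally show ?thesis .
    qed
    then show "{\<alpha>\<in>J. \<not> \<psi> \<alpha> \<le> e} \<subseteq> {\<alpha>\<in>J. \<Upsilon> \<alpha> > min 1 (e / \<kappa>)}"
      by (metis (mono_tags, lifting) Collect_mono not_le)
  qed
  define c' where "c' = c / (2 * (20 * \<kappa>) ^ ?n * ?\<omega>)"
  have c': "0 < c'" using \<open>0 < c\<close> \<kappa> unfolding c'_def by (intro divide_pos_pos mult_pos_pos) auto
  have "negligible (ball x s - ?L)"
  proof (rule negligible_diff_if_fraction_of_balls[OF _ _ limsup_set_lebesgue[OF J] c'])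
    fix z :: 'a and r :: real
    assume r: "0 < r" "cball z r \<subseteq> ball x s"
    have "cball z (r / 2) \<subseteq> ball x s" using subset_cball[of "r / 2" r z] r by auto
    then have "c * (r / 2) ^ ?n \<le> measure lebesgue (cball z (r / 2) \<inter> limsup_set J R \<psi>)"
      using ample[of "r / 2" z] r(1) by (simp add: \<psi>_def[abs_def])
    moreover have "c * (r / 2) ^ ?n / 2 < c * (r / 2) ^ ?n" using \<open>0 < c\<close> r(1) by simp
    ultimately have v: "c * (r / 2) ^ ?n / 2 < measure lebesgue (cball z (r / 2) \<inter> limsup_set J R \<psi>)"
      by simp
    have "c' * measure lebesgue (cball z r) = c' * (?\<omega> * r ^ ?n)"
      using r(1) by (simp add: content_cball)
    also have "\<dots> = c * (r / 2) ^ ?n / 2 / (10 * \<kappa>) ^ ?n"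
    proof -
      have "(20::real) ^ ?n = 10 ^ ?n * 2 ^ ?n" by (simp flip: power_mult_distrib)
      moreover have "?\<omega> \<noteq> 0" by (metis less_irrefl of_nat_0_le_iff unit_ball_vol_pos)
      ultimately show ?thesis using \<kappa> by (simp add: c'_def power_divide power_mult_distrib)
    qed
    also have "\<dots> \<le> measure lebesgue (cball z r \<inter> ?L)"
      using \<open>0 < c\<close> r(1)
      by (intro limsup_set_volume_ge[OF ne J small \<kappa> fin\<kappa> r(1) _ v]) auto
    finally show "c' * measure lebesgue (cball z r) \<le> measure lebesgue (cball z r \<inter> ?L)" .
  qed auto
  then have "negligible ((ball x s - ?L) \<union> sphere x s)" by (intro negligible_Un negligible_sphere)
  then have null: "cball x s - ?L \<in> null_sets lebesgue"
    unfolding negligible_iff_null_sets[symmetric] by (rule negligible_subset) auto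
  have "ennreal ?\<omega> * hausdorff_measure f (cball x s - ?L) \<le> ennreal (C * 5 ^ ?n) * emeasure lebesgue (cball x s - ?L)"
    using null f_le \<open>0 \<le> C\<close> by (intro hausdorff_measure_le_volume) auto
  also have "emeasure lebesgue (cball x s - ?L) = 0" using null by auto
  finally have "ennreal ?\<omega> * hausdorff_measure f (cball x s - ?L) = 0" by simp
  moreover have "0 < ?\<omega>" by simp
  ultimately show ?thesis by simp
qed

theorem theorem3:
  fixes m l :: nat
    and J :: "'j set"
    and R :: "'j \<Rightarrow> (real ^ 'k) set"
    and \<Upsilon> :: "'j \<Rightarrow> real"
    and V \<Omega> :: "(real ^ 'k) set"
    and f g :: "real \<Rightarrow> real"
  assumes "1 \<le> m" and "CARD('k) = m + l"
    and "countable J" and "infinite J"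
    and "\<And>\<alpha>. \<alpha> \<in> J \<Longrightarrow> affine (R \<alpha>) \<and> aff_dim (R \<alpha>) = int l"
    and "\<And>\<alpha>. \<alpha> \<in> J \<Longrightarrow> 0 \<le> \<Upsilon> \<alpha>"
    and "\<And>\<epsilon>. 0 < \<epsilon> \<Longrightarrow> finite {\<alpha>\<in>J. \<Upsilon> \<alpha> > \<epsilon>}"
    and "subspace V" and "dim V = m"
    and "\<And>\<alpha>. \<alpha> \<in> J \<Longrightarrow> V \<inter> R \<alpha> \<noteq> {}"
    and "(SUP \<alpha>\<in>J. ediameter (V \<inter> nbhd (R \<alpha>) 1)) < \<infinity>"
    and "dimension_function f" and "dimension_function g"
    and "\<And>r. 0 < r \<Longrightarrow> g r = f r / r ^ l" and "g 0 = 0"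
    and "mono_on {0<..} (\<lambda>r. f r / r ^ CARD('k)) \<or> antimono_on {0<..} (\<lambda>r. f r / r ^ CARD('k))"
    and "is_ball \<Omega>"
    and "\<And>B. is_ball B \<Longrightarrow> B \<subseteq> \<Omega> \<Longrightarrow>
           hausdorff_measure (\<lambda>r. r ^ CARD('k)) (B \<inter> limsup_set J R (\<lambda>\<alpha>. root m (g (\<Upsilon> \<alpha>))))
             = hausdorff_measure (\<lambda>r. r ^ CARD('k)) B"
  shows "\<forall>B. is_ball B \<and> B \<subseteq> \<Omega> \<longrightarrow>
           hausdorff_measure f (B \<inter> limsup_set J R \<Upsilon>) = hausdorff_measure f B"
proof (intro allI impI)
  fix B :: "(real ^ 'k) set" assume "is_ball B \<and> B \<subseteq> \<Omega>"
  then obtain x s where B: "0 < s" "B = ball x s \<or> B = cball x s" "B \<subseteq> \<Omega>"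
    by (auto simp: is_ball_def ball_with_radius_def)
  let ?n = "CARD('k)" and ?\<omega> = "unit_ball_vol (real CARD('k))"
  have dim: "DIM(real ^ 'k) = m + l" using assms(2) by simp
  have fg: "f t = g t * t ^ l" if "0 < t" for t using assms(14)[OF that] that by simp
  have ne: "R \<alpha> \<noteq> {}" if "\<alpha> \<in> J" for \<alpha> using assms(10)[OF that] by blast
  have balls: "ball x s \<subseteq> B" "B \<subseteq> cball x s" using B(2) ball_subset_cball by auto
  define c where "c = ?\<omega> / 5 ^ ?n"
  have c: "0 < c" by (simp add: c_def unit_ball_vol_pos)
  have ample: "c * r ^ DIM(real ^ 'k)
      \<le> measure lebesgue (cball z r \<inter> limsup_set J R (\<lambda>\<alpha>. root m (g (\<Upsilon> \<alpha>))))"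
    if r: "0 < r" "cball z r \<subseteq> \<Omega>" for z r
  proof -
    let ?L = "limsup_set J R (\<lambda>\<alpha>. root m (g (\<Upsilon> \<alpha>)))"
    have ball: "ball_with_radius (cball z r) r" using r(1) by (rule ball_with_radius_cball)
    then have "is_ball (cball z r)" by (auto simp: is_ball_def)
    then have full: "hausdorff_measure (\<lambda>t. t ^ DIM(real ^ 'k)) (cball z r \<inter> ?L)
        = hausdorff_measure (\<lambda>t. t ^ DIM(real ^ 'k)) (cball z r)"
      using assms(18)[OF _ r(2)] by simp
    show ?thesis
      using measure_Int_ge_if_full_hausdorff_measure[OF ball limsup_set_lebesgue[OF assms(3)] full]
      by (simp add: c_def power_divide)
  qed
  show "hausdorff_measure f (B \<inter> limsup_set J R \<Upsilon>) = hausdorff_measure f B"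
  proof (cases "\<exists>C\<ge>0. \<forall>t. 0 < t \<longrightarrow> t \<le> 1 \<longrightarrow> f t \<le> C * t ^ ?n")
    case True
    then obtain C where C: "0 \<le> C" "\<And>t. 0 < t \<Longrightarrow> t \<le> 1 \<Longrightarrow> f t \<le> C * t ^ DIM(real ^ 'k)" by auto
    have "hausdorff_measure f (cball x s - limsup_set J R \<Upsilon>) = 0"
    proof (rule hausdorff_measure_diff_limsup_set_eq_0[OF dim assms(1,3) ne assms(6,7) fg assms(15) C c])
      fix z r assume "0 < r" "cball z r \<subseteq> ball x s"
      then show "c * r ^ DIM(real ^ 'k)
          \<le> measure lebesgue (cball z r \<inter> limsup_set J R (\<lambda>\<alpha>. root m (g (\<Upsilon> \<alpha>))))"
        using balls(1) B(3) by (intro ample) auto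
    qed
    moreover have "hausdorff_measure f (B - limsup_set J R \<Upsilon>)
        \<le> hausdorff_measure f (cball x s - limsup_set J R \<Upsilon>)"
      using balls(2) by (intro hausdorff_measure_mono) auto
    ultimately show ?thesis by (intro hausdorff_measure_eq_if_null_diff) simp
  next
    case False
    \<comment> \<open>If the ratio were increasing, its value at \<open>1\<close> would bound it near \<open>0\<close>; so it is decreasing and the gauge is steep.\<close>
    have unbounded: "\<exists>t>0. t \<le> 1 \<and> A < f t / t ^ ?n" for A
    proof -
      obtain t where "0 < t" "t \<le> 1" "max A 0 * t ^ ?n < f t" using False by (meson max.cobounded2 not_le)
      then have "max A 0 < f t / t ^ ?n" by (simp add: less_divide_eq)
      then show ?thesis using \<open>0 < t\<close> \<open>t \<le> 1\<close> by auto
    qed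
    have anti: "antimono_on {0<..} (\<lambda>r. f r / r ^ ?n)"
    proof (rule ccontr)
      assume "\<not> ?thesis"
      then have mono: "mono_on {0<..} (\<lambda>r. f r / r ^ ?n)" using assms(16) by blast
      obtain t where "0 < t" "t \<le> 1" "f 1 < f t / t ^ ?n" using unbounded by blast
      then show False using monotone_onD[OF mono, of t 1] by simp
    qed
    have gauge: "steep_gauge f g m l"
    proof (rule steep_gauge.intro[OF assms(1) fg])
      show "g s \<le> g t" if "0 < s" "s \<le> t" for s t
        using assms(13) that by (auto simp: dimension_function_def intro: mono_onD)
      show "(g \<longlongrightarrow> 0) (at_right 0)" using assms(13) by (simp add: dimension_function_def)
      show "f t / t ^ (m + l) \<le> f s / s ^ (m + l)" if "0 < s" "s \<le> t" for s t
        using monotone_onD[OF anti, of s t] that by (simp add: assms(2))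
      show "\<exists>t>0. A < f t / t ^ (m + l)" for A using unbounded[of A] unfolding assms(2) by blast
    qed
    interpret plane_system f g m l J R \<Upsilon> "\<lambda>\<alpha>. root m (g (\<Upsilon> \<alpha>))" \<Omega> c
      by (intro plane_system.intro plane_system_axioms.intro gauge dim assms(3,5,6,7,15) refl c ample)
    have sub: "cball x (s / 2) \<subseteq> B" using balls(1) B(1) by (auto simp: subset_iff)
    then have "\<infinity> = hausdorff_measure f (cball x (s / 2) \<inter> limsup_set J R \<Upsilon>)"
      using B by (intro hausdorff_measure_limsup_set_eq_infinity[symmetric]) auto
    also have "\<dots> \<le> hausdorff_measure f (B \<inter> limsup_set J R \<Upsilon>)"
      using sub by (intro hausdorff_measure_mono) auto
    finally have "hausdorff_measure f (B \<inter> limsup_set J R \<Upsilon>) = \<infinity>" by (simp add: top_unique)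
    moreover have "hausdorff_measure f (B \<inter> limsup_set J R \<Upsilon>) \<le> hausdorff_measure f B"
      by (intro hausdorff_measure_mono) auto
    ultimately show ?thesis by (simp add: top_unique)
  qed
qed

end
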